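(* Let $i\in\{1,\ldots,d\}$ be fixed and let $\boldsymbol Z\in\mathbb{R}_+^d$ be a random vector such that $\boldsymbol Z\in\mathcal{MRV}(\alpha_i,b_i,\mu_i,\mathbb{E}_d^{(i)})$, where $b_i$ is the canonical choice of the scaling function. Let $\boldsymbol A\in\mathbb{R}_+^{q\times d}$ be a random matrix, independent of $\boldsymbol Z$, which almost surely has no trivial (i.e. zero) row. Assume that for some $k\in\{1,\ldots,q\}$ the following conditions hold: (i) for some $\delta=\delta(i,k)>0$, $$\mathbf E_i^{(k)}\big[\tau_{q,d}^{(k,i)}(\boldsymbol A)^{\alpha_i+\delta}\big]=\int_{\Omega_i^{(k)}}\tau_{q,d}^{(k,i)}(\boldsymbol A)^{\alpha_i+\delta}\,\mathrm d\mathbf P<\infty;$$ (ii) $\mu_i\big(\widetilde{\mathbb{CA}}_d^{(i)}(j)\big)>0$ for all $j=1,\ldots,\binom di$. Then, as $t\to\infty$, $$\frac{\mathbf P_i^{(k)}(\boldsymbol A\boldsymbol Z\in t\,\cdot\,)}{\mathbf P(\tau_d^{(i)}(\boldsymbol Z)>t)}\;\to\;\mathbf E_i^{(k)}\big[\mu_i(\{\boldsymbol z\in\mathbb{E}_d^{(i)}:\boldsymbol A\boldsymbol z\in\,\cdot\,\})\big]=:\overline\mu_{i,k}(\cdot)\qquad\text{in }\mathbb{M}(\mathbb{E}_q^{(k)}).$$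
   Context: Let $d,q\ge1$ be integers and $\mathbb{R}_+=[0,\infty)$. All random elements live on one probability space $(\Omega,\mathcal F,\mathbf P)$. For $\boldsymbol v\in\mathbb{R}_+^d$, $v^{(1)}\ge\cdots\ge v^{(d)}$ denote its components in decreasing order. Distances are with respect to the sup-norm; a set $\Lambda$ is bounded away from $C_0$ if $\inf\{\|\boldsymbol x-\boldsymbol y\|_\infty:\boldsymbol x\in\Lambda,\boldsymbol y\in C_0\}>0$. Subcones. $\mathbb{CA}_d^{(0)}=\{\boldsymbol 0\}$ and $\mathbb{CA}_d^{(i)}=\{\boldsymbol v\in\mathbb{R}_+^d:v^{(i+1)}=0\}$ for $1\le i\le d-1$; $\mathbb{E}_d^{(i)}=\mathbb{R}_+^d\setminus\mathbb{CA}_d^{(i-1)}=\{\boldsymbol v\in\mathbb{R}_+^d:v^{(i)}>0\}$ for $1\le i\le d$; analogously with $q$ in place of $d$. For $1\le i\le d$, the sets $\widetilde{\mathbb{CA}}_d^{(i)}(j)$, $j=1,\ldots,\binom di$, are an enumeration of the sets $\{\boldsymbol v\in\mathbb{R}_+^d: v_l>0\text{ for }l\in J,\ v_l=0\text{ for }l\notin J\}$, where $J$ runs over the $i$-element subsets of $\{1,\ldots,d\}$. Convergence. $\mathbb{M}(\mathbb{E}_d^{(i)})$ is the class of Borel measures on $\mathbb{E}_d^{(i)}$ that are finite on Borel sets bounded away from $\mathbb{CA}_d^{(i-1)}$. Measures $\mu_t\to\mu$ in $\mathbb{M}(\mathbb{E}_d^{(i)})$ as $t\to\infty$ if $\int f\,d\mu_t\to\int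 f\,d\mu$ for every bounded continuous real-valued $f$ on $\mathbb{E}_d^{(i)}$ whose support is bounded away from $\mathbb{CA}_d^{(i-1)}$. Regular variation. A function $f:\mathbb{R}_+\to\mathbb{R}_+$ is in $\mathcal{RV}_\beta$ if $f(tx)/f(t)\to x^\beta$ as $t\to\infty$ for all $x>0$. A random vector $\boldsymbol V\in\mathbb{R}_+^d$ satisfies $\boldsymbol V\in\mathcal{MRV}(\alpha,b,\mu,\mathbb{E}_d^{(i)})$, with $\alpha>0$, $b\in\mathcal{RV}_{1/\alpha}$ and $\mu\in\mathbb{M}(\mathbb{E}_d^{(i)})$ non-null, if $t\,\mathbf P(\boldsymbol V/b(t)\in\cdot)\to\mu(\cdot)$ in $\mathbb{M}(\mathbb{E}_d^{(i)})$ as $t\to\infty$. The canonical choice of the scaling function is $b_i(t)=F_{V^{(i)}}^{\leftarrow}(1-1/t)$, where $F_{V^{(i)}}$ is the distribution function of $V^{(i)}$ and $F^{\leftarrow}(s)=\inf\{x\in\mathbb{R}:F(x)\ge s\}$. The functions $\tau$. $\tau_d^{(i)}(\boldsymbol z)=z^{(i)}$ for $\boldsymbol z\in\mathbb{R}_+^d$, $\tau_q^{(k)}(\boldsymbol x)=x^{(k)}$ for $\boldsymbol x\in\mathbb{R}_+^q$, and for a deterministic matrix $\boldsymbol B\in\mathbb{R}_+^{q\times d}$, $$\tau_{q,d}^{(k,i)}(\boldsymbol B)=\sup_{\boldsymbol z\in\mathbb{E}_d^{(i)}}\frac{(\boldsymbol B\boldsymbol z)^{(k)}}{z^{(i)}}\in[0,\infty].$$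 Partition of $\Omega$. With $\boldsymbol A_\omega=\boldsymbol A(\omega)$, let $i_k(\boldsymbol A_\omega)=\max\{j\in\{1,\ldots,d\}:\tau_{q,d}^{(k,j)}(\boldsymbol A_\omega)<\infty\}$ (this set always contains $1$), $\Omega_i^{(k)}=\{\omega\in\Omega:i_k(\boldsymbol A_\omega)=i\}$, $\mathbf P_i^{(k)}(\cdot)=\mathbf P(\cdot\cap\Omega_i^{(k)})$ and $\mathbf E_i^{(k)}[\cdot]=\mathbf E[\,\cdot\,\mathbf 1_{\Omega_i^{(k)}}]$, where $\mathbf E$ is expectation under $\mathbf P$. *)

theory Defs
  imports "HOL-Probability.Probability"
begin

definition nonneg_orthant :: "(real ^ 'n::finite) set" where
  "nonneg_orthant = {v. \<forall>l. 0 \<le> v $ l}"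

text \<open>The decreasing rearrangement: \<open>ord_stat v i\<close> is the \<open>i\<close>-th largest component
  (counted with multiplicity), meaningful for \<open>1 \<le> i \<le> CARD('n)\<close>.\<close>

definition ord_stat :: "real ^ 'n::finite \<Rightarrow> nat \<Rightarrow> real" where
  "ord_stat v i =
     rev (sorted_list_of_multiset (image_mset (\<lambda>l. v $ l) (mset_set UNIV))) ! (i - 1)"

text \<open>The dimension is carried by the type: \<open>coord_cone i :: (real ^ 'd) set\<close> is the cone
  \<open>CA\<close> of index \<open>i\<close> in dimension \<open>CARD('d)\<close>.\<close>

definition coord_cone :: "nat \<Rightarrow> (real ^ 'n::finite) set" where
  "coord_cone i = (if i = 0 then {0} else {v \<in> nonneg_orthant. ord_stat v (Suc i) = 0})"

definition subcone :: "nat \<Rightarrow> (real ^ 'n::finite) set" where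
  "subcone i = nonneg_orthant - coord_cone (i - 1)"

text \<open>The sets \<open>open_face J\<close> with \<open>card J = i\<close> are the sets written \<open>CA\<close>-tilde of index \<open>i\<close>.\<close>

definition open_face :: "'n set \<Rightarrow> (real ^ 'n::finite) set" where
  "open_face J = {v \<in> nonneg_orthant. (\<forall>l\<in>J. 0 < v $ l) \<and> (\<forall>l. l \<notin> J \<longrightarrow> v $ l = 0)}"

text \<open>The infimum is taken in \<open>ereal\<close>, so that the empty set is bounded away from everything.\<close>

definition bounded_away :: "(real ^ 'n::finite) set \<Rightarrow> (real ^ 'n) set \<Rightarrow> bool" where
  "bounded_away S C \<longleftrightarrow> 0 < (INF (x, y)\<in>S \<times> C. ereal (infnorm (x - y)))"

definition subcone_borel :: "nat \<Rightarrow> (real ^ 'n::finite) measure" where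
  "subcone_borel i = restrict_space borel (subcone i)"

definition M_class :: "nat \<Rightarrow> (real ^ 'n::finite) measure set" where
  "M_class i = {\<mu>. sets \<mu> = sets (subcone_borel i) \<and>
     (\<forall>S\<in>sets \<mu>. bounded_away S (coord_cone (i - 1)) \<longrightarrow> emeasure \<mu> S < \<infinity>)}"

definition M_test :: "nat \<Rightarrow> (real ^ 'n::finite \<Rightarrow> real) set" where
  "M_test i = {f. continuous_on (subcone i) f \<and> bounded (f ` subcone i) \<and>
     bounded_away (subcone i \<inter> closure {x \<in> subcone i. f x \<noteq> 0}) (coord_cone (i - 1))}"

definition M_converges ::
  "nat \<Rightarrow> (real \<Rightarrow> (real ^ 'n::finite) measure) \<Rightarrow> (real ^ 'n) measure \<Rightarrow> bool" where
  "M_converges i \<mu>s \<mu> \<longleftrightarrow>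
     (\<forall>\<^sub>F t in at_top. \<mu>s t \<in> M_class i) \<and> \<mu> \<in> M_class i \<and>
     (\<forall>f\<in>M_test i. ((\<lambda>t. integral\<^sup>L (\<mu>s t) f) \<longlongrightarrow> integral\<^sup>L \<mu> f) at_top)"

text \<open>Nonnegativity is only required near infinity: the canonical scaling function below is
  not specified for \<open>t \<le> 1\<close>, and only large arguments enter the limit.\<close>

definition regularly_varying :: "real \<Rightarrow> (real \<Rightarrow> real) \<Rightarrow> bool" where
  "regularly_varying \<beta> f \<longleftrightarrow> (\<forall>\<^sub>F t in at_top. 0 \<le> f t) \<and>
     (\<forall>x>0. ((\<lambda>t. f (t * x) / f t) \<longlongrightarrow> x powr \<beta>) at_top)"

definition MRV :: "'w measure \<Rightarrow> ('w \<Rightarrow> real ^ 'n::finite) \<Rightarrow> real \<Rightarrow> (real \<Rightarrow> real) \<Rightarrow>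
    (real ^ 'n) measure \<Rightarrow> nat \<Rightarrow> bool" where
  "MRV P V \<alpha> b \<mu> i \<longleftrightarrow>
     0 < \<alpha> \<and> regularly_varying (1 / \<alpha>) b \<and>
     \<mu> \<in> M_class i \<and> emeasure \<mu> (space \<mu>) \<noteq> 0 \<and>
     M_converges i
       (\<lambda>t. scale_measure (ennreal t)
              (restrict_space (distr P borel (\<lambda>\<omega>. V \<omega> /\<^sub>R b t)) (subcone i))) \<mu>"

definition left_inverse :: "(real \<Rightarrow> real) \<Rightarrow> real \<Rightarrow> real" where
  "left_inverse F s = Inf {x. s \<le> F x}"

text \<open>For \<open>t > 1\<close> the infimum is over a nonempty set bounded below.\<close>

definition canonical_scaling ::
  "'w measure \<Rightarrow> ('w \<Rightarrow> real ^ 'n::finite) \<Rightarrow> nat \<Rightarrow> real \<Rightarrow> real" where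
  "canonical_scaling P V i t =
     left_inverse (cdf (distr P borel (\<lambda>\<omega>. ord_stat (V \<omega>) i))) (1 - 1 / t)"

text \<open>For matrices with nonnegative entries the quotient is nonnegative, so \<open>ennreal\<close> does
  not truncate.\<close>

definition \<tau>_mat :: "nat \<Rightarrow> nat \<Rightarrow> real ^ 'd::finite ^ 'q::finite \<Rightarrow> ennreal" where
  "\<tau>_mat k i B = (SUP z\<in>subcone i. ennreal (ord_stat (B *v z) k / ord_stat z i))"

definition index_of :: "nat \<Rightarrow> real ^ 'd::finite ^ 'q::finite \<Rightarrow> nat" where
  "index_of k B = Max {j \<in> {1..CARD('d)}. \<tau>_mat k j B < \<infinity>}"

definition \<Omega>_part ::
  "'w measure \<Rightarrow> ('w \<Rightarrow> real ^ 'd::finite ^ 'q::finite) \<Rightarrow> nat \<Rightarrow> nat \<Rightarrow> 'w set" where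
  "\<Omega>_part P A k i = {\<omega> \<in> space P. index_of k (A \<omega>) = i}"

definition P_part ::
  "'w measure \<Rightarrow> ('w \<Rightarrow> real ^ 'd::finite ^ 'q::finite) \<Rightarrow> nat \<Rightarrow> nat \<Rightarrow> 'w measure" where
  "P_part P A k i = density P (indicator (\<Omega>_part P A k i))"

text \<open>The normalised law \<open>P_part (A Z \<in> t B) / P (ord_stat Z i > t)\<close>, as a measure in
  \<open>B \<subseteq> subcone k\<close>; for \<open>t > 0\<close>, \<open>A Z \<in> t B\<close> means \<open>A Z /\<^sub>R t \<in> B\<close>.\<close>

definition normalised_law :: "'w measure \<Rightarrow> ('w \<Rightarrow> real ^ 'd::finite ^ 'q::finite) \<Rightarrow>
    ('w \<Rightarrow> real ^ 'd) \<Rightarrow> nat \<Rightarrow> nat \<Rightarrow> real \<Rightarrow> (real ^ 'q) measure" where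
  "normalised_law P A Z k i t =
     scale_measure (1 / emeasure P {\<omega> \<in> space P. ord_stat (Z \<omega>) i > t})
       (restrict_space (distr (P_part P A k i) borel (\<lambda>\<omega>. (A \<omega> *v Z \<omega>) /\<^sub>R t)) (subcone k))"

definition limit_fun :: "'w measure \<Rightarrow> ('w \<Rightarrow> real ^ 'd::finite ^ 'q::finite) \<Rightarrow>
    (real ^ 'd) measure \<Rightarrow> nat \<Rightarrow> nat \<Rightarrow> (real ^ 'q) set \<Rightarrow> ennreal" where
  "limit_fun P A \<mu> k i S =
     (\<integral>\<^sup>+\<omega>\<in>\<Omega>_part P A k i. emeasure \<mu> {z \<in> subcone i. A \<omega> *v z \<in> S} \<partial>P)"

text \<open>\<open>measure_of\<close> returns the null measure when its argument is not a measure; statements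
  about \<open>limit_measure\<close> should therefore also assert \<open>measure_space\<close> of \<open>limit_fun\<close>.\<close>

definition limit_measure :: "'w measure \<Rightarrow> ('w \<Rightarrow> real ^ 'd::finite ^ 'q::finite) \<Rightarrow>
    (real ^ 'd) measure \<Rightarrow> nat \<Rightarrow> nat \<Rightarrow> (real ^ 'q) measure" where
  "limit_measure P A \<mu> k i =
     measure_of (subcone k) (sets (subcone_borel k)) (limit_fun P A \<mu> k i)"

text \<open>The library's \<open>indep_var\<close> needs both variables to have the same type; this is the same
  notion for a random matrix and a random vector.\<close>

definition indep_rv :: "'w measure \<Rightarrow> ('w \<Rightarrow> 'a::topological_space) \<Rightarrow>
    ('w \<Rightarrow> 'b::topological_space) \<Rightarrow> bool" where
  "indep_rv P X Y \<longleftrightarrow> prob_space.indep_set P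
     (sets (vimage_algebra (space P) X borel)) (sets (vimage_algebra (space P) Y borel))"

end

theory Submission
  imports Defs
begin

text \<open>
  The \<open>i\<close>-th largest component is the sup-norm distance to the cone removed from \<open>subcone i\<close>, so
  everything is governed by the tail \<open>U t = P(Z\<^sup>(\<^sup>i\<^sup>) > t)\<close>. For the canonical scaling \<open>b\<close>,
  \<open>t = 1 / U s\<close> gives \<open>s / b t \<rightarrow> 1\<close>, hence \<open>E f(Z / s) / U s \<rightarrow> \<integral> f d\<mu>\<close> for every test function.
  Conditionally on \<open>A\<close>, on the event where \<open>\<tau>\<close> is finite, \<open>z \<mapsto> f (A z)\<close> is itself a test function
  on \<open>subcone i\<close>, because \<open>(A z)\<^sup>(\<^sup>k\<^sup>) \<le> \<tau> z\<^sup>(\<^sup>i\<^sup>)\<close>. So the conditional expectations converge, and Potter's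
  bound \<open>U (t / x) \<le> C x\<^sup>p U t\<close> with \<open>p = \<alpha> + \<delta>\<close> together with the moment condition gives an
  integrable dominating function for integrating out \<open>A\<close>.
\<close>

section \<open>Order statistics, cones and test functions\<close>

text \<open>Two obstacles shape the proof. First, \<open>U\<close> may jump, so
  \<open>U (b t) = 1 / t\<close> can fail and \<open>b\<close> is handled only through the two
  one-sided inequalities of a left inverse. Replacing \<open>b (1 / U s)\<close> by \<open>s\<close>
  dilates the argument of a test function slightly. Supports of test functions may be unbounded, so
  uniform continuity is available only on bounded parts, and the rest is absorbed by a continuous
  cutoff that carries little mass. Second, for fixed \<omega> the support of
  \<open>z \<mapsto> f (A z)\<close> is only known to stay \<open>a / (\<tau> + 1)\<close> away from
  the cone, a distance that may degenerate as \<omega> varies, so no single test function serves all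
  matrices. The factor \<open>2 * \<tau> / a + 1\<close> measures this loss and is what enters
  Potter's bound as \<open>x\<close>. The slack \<open>p > \<alpha>\<close> is what turns an
  asymptotic doubling relation into an inequality for all large arguments, which can then be
  iterated. The same bound, passed to the limit, controls \<open>\<mu>\<close> near the cone and
  makes the limit measure finite on sets bounded away from its cone. That limit is built as an image
  of a product measure, so its countable additivity is automatic.\<close>

text \<open>Induction at the end of the list: the last element is the maximum and becomes the head
  of the reversed list; if it lies below \<open>c\<close>, the filter is empty.\<close>

lemma le_nth_rev_sorted_iff:
  fixes xs :: "'a::linorder list"
  assumes "sorted xs" "j < length xs"
  shows "c \<le> rev xs ! j \<longleftrightarrow> j < length (filter (\<lambda>x. c \<le> x) xs)"
  using assms
proof (induction xs arbitrary: j rule: rev_induct)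
  case Nil
  then show ?case by simp
next
  case (snoc x xs)
  have le: "\<And>y. y \<in> set xs \<Longrightarrow> y \<le> x" and s: "sorted xs"
    using snoc.prems by (auto simp: sorted_append)
  have none: "filter ((\<le>) c) xs = []" if "\<not> c \<le> x"
    using le that by (force simp: filter_empty_conv)
  show ?case
  proof (cases j)
    case 0
    then show ?thesis using none by auto
  next
    case (Suc j')
    then have j': "j' < length xs" using snoc.prems by simp
    have "rev xs ! j' \<in> set xs" using j' by (metis length_rev nth_mem set_rev)
    then have "rev xs ! j' \<le> x" by (rule le)
    with snoc.IH[OF s j'] none Suc show ?thesis by auto
  qed
qed

text \<open>Counting replaces sorting: the definition of \<open>ord_stat\<close> is not unfolded
  again after this characterisation.\<close>

lemma le_ord_stat_iff:
  fixes v :: "real ^ 'n::finite"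
  assumes "i \<in> {1..CARD('n)}"
  shows "c \<le> ord_stat v i \<longleftrightarrow> i \<le> card {l. c \<le> v $ l}"
proof -
  define xs where "xs = sorted_list_of_multiset (image_mset (\<lambda>l. v $ l) (mset_set UNIV))"
  have m: "mset xs = image_mset (\<lambda>l. v $ l) (mset_set UNIV)" by (simp add: xs_def)
  have "length (filter (\<lambda>x. c \<le> x) xs) = size (filter_mset (\<lambda>x. c \<le> x) (mset xs))"
    by (simp flip: mset_filter)
  also have "\<dots> = card {l. c \<le> v $ l}"
    by (simp add: m filter_mset_image_mset)
  finally have f: "length (filter (\<lambda>x. c \<le> x) xs) = card {l. c \<le> v $ l}" .
  have "length xs = CARD('n)" by (metis m size_image_mset size_mset size_mset_set)
  then have "i - 1 < length xs" using assms by auto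
  then have "c \<le> rev xs ! (i - 1) \<longleftrightarrow> i - 1 < card {l. c \<le> v $ l}"
    using le_nth_rev_sorted_iff[of xs "i - 1" c] f by (simp add: xs_def)
  with assms show ?thesis by (auto simp: ord_stat_def xs_def[symmetric])
qed

text \<open>Wherever \<open>v\<close> reaches its own order statistic, \<open>w\<close> reaches that
  value minus \<open>e\<close>, so the count for \<open>w\<close> is at least as large. Used both
  ways it gives the Lipschitz bound, and with \<open>e = 0\<close> monotonicity.\<close>

lemma ord_stat_le_add:
  fixes v w :: "real ^ 'n::finite"
  assumes i: "i \<in> {1..CARD('n)}" and le: "\<And>l. v $ l \<le> w $ l + e"
  shows "ord_stat v i \<le> ord_stat w i + e"
proof -
  have "i \<le> card {l. ord_stat v i \<le> v $ l}" using le_ord_stat_iff[OF i] by blast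
  also have "\<dots> \<le> card {l. ord_stat v i - e \<le> w $ l}"
    using le by (intro card_mono) (auto simp: algebra_simps intro: order_trans)
  finally have "ord_stat v i - e \<le> ord_stat w i" using le_ord_stat_iff[OF i] by blast
  then show ?thesis by simp
qed

lemma abs_ord_stat_diff_le_infnorm:
  fixes v w :: "real ^ 'n::finite"
  assumes i: "i \<in> {1..CARD('n)}"
  shows "\<bar>ord_stat v i - ord_stat w i\<bar> \<le> infnorm (v - w)"
proof -
  have "v $ l \<le> w $ l + infnorm (v - w)" "w $ l \<le> v $ l + infnorm (v - w)" for l
    using component_le_infnorm_cart[of "v - w" l] by (auto simp: abs_le_iff)
  with ord_stat_le_add[OF i, of v w "infnorm (v - w)"] ord_stat_le_add[OF i, of w v "infnorm (v - w)"]
  show ?thesis by (simp add: abs_le_iff)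
qed

lemma continuous_on_ord_stat:
  assumes i: "i \<in> {1..CARD('n)}"
  shows "continuous_on S (\<lambda>v :: real ^ 'n::finite. ord_stat v i)"
proof (rule uniformly_continuous_imp_continuous, unfold uniformly_continuous_on_def, intro allI impI)
  fix e :: real assume "e > 0"
  moreover have "dist (ord_stat v i) (ord_stat w i) \<le> dist v w" for v w :: "real ^ 'n"
    using abs_ord_stat_diff_le_infnorm[OF i, of v w] infnorm_le_norm[of "v - w"]
    by (simp add: dist_norm)
  ultimately show "\<exists>d>0. \<forall>x\<in>S. \<forall>x'\<in>S. dist x' x < d \<longrightarrow>
      dist (ord_stat x' i) (ord_stat x i) < e"
    by (intro exI[of _ e]) (auto intro: le_less_trans)
qed

lemma measurable_ord_stat [measurable]:
  "i \<in> {1..CARD('n)} \<Longrightarrow> (\<lambda>v :: real ^ 'n::finite. ord_stat v i) \<in> borel_measurable borel"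
  by (intro borel_measurable_continuous_onI continuous_on_ord_stat)

lemma ord_stat_nonneg:
  fixes v :: "real ^ 'n::finite"
  assumes i: "i \<in> {1..CARD('n)}" and v: "v \<in> nonneg_orthant"
  shows "0 \<le> ord_stat v i"
  using assms by (subst le_ord_stat_iff) (auto simp: nonneg_orthant_def)

lemma ord_stat_scale:
  fixes v :: "real ^ 'n::finite"
  assumes i: "i \<in> {1..CARD('n)}" and r: "0 < r"
  shows "ord_stat (r *\<^sub>R v) i = r * ord_stat v i"
proof (rule antisym)
  have "c \<le> ord_stat (r *\<^sub>R v) i \<longleftrightarrow> c / r \<le> ord_stat v i" for c
    using r by (simp add: le_ord_stat_iff[OF i] pos_divide_le_eq mult.commute)
  from this[of "ord_stat (r *\<^sub>R v) i"] this[of "r * ord_stat v i"] r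
  show "ord_stat (r *\<^sub>R v) i \<le> r * ord_stat v i" "r * ord_stat v i \<le> ord_stat (r *\<^sub>R v) i"
    by (auto simp: pos_divide_le_eq mult.commute)
qed

lemma ord_stat_zero:
  assumes i: "i \<in> {1..CARD('n)}"
  shows "ord_stat (0 :: real ^ 'n::finite) i = 0"
  using ord_stat_scale[OF i, of 2 0] by simp

text \<open>The separate clause of \<open>coord_cone\<close> for index 0 fits the general pattern,
  because a nonnegative vector whose largest component is 0 vanishes. The cone of index
  \<open>i - 1\<close> is the one removed from \<open>subcone i\<close>.\<close>

lemma coord_cone_eq:
  assumes i: "i \<in> {1..CARD('n)}"
  shows "(coord_cone (i - 1) :: (real ^ 'n::finite) set) = {v \<in> nonneg_orthant. ord_stat v i = 0}"
proof (cases "i = 1")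
  case True
  have "v = 0" if v: "v \<in> nonneg_orthant" and 0: "ord_stat v 1 = 0" for v :: "real ^ 'n"
  proof (rule ccontr)
    assume "v \<noteq> 0"
    then obtain l where "v $ l \<noteq> 0" by (auto simp: vec_eq_iff)
    with v have l: "0 < v $ l" by (auto simp: nonneg_orthant_def less_le)
    have "{l} \<subseteq> {m. v $ l \<le> v $ m}" by auto
    then have "1 \<le> card {m. v $ l \<le> v $ m}" using card_mono[of "{m. v $ l \<le> v $ m}" "{l}"] by simp
    then have "v $ l \<le> ord_stat v 1" using le_ord_stat_iff[of 1 _ v] i True by simp
    with l 0 show False by simp
  qed
  then show ?thesis using True ord_stat_zero[OF i]
    by (auto simp: coord_cone_def nonneg_orthant_def)
next
  case False
  with i show ?thesis by (auto simp: coord_cone_def)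
qed

lemma subcone_eq:
  assumes i: "i \<in> {1..CARD('n)}"
  shows "(subcone i :: (real ^ 'n::finite) set) = {v \<in> nonneg_orthant. 0 < ord_stat v i}"
  unfolding subcone_def coord_cone_eq[OF i] using ord_stat_nonneg[OF i]
  by (auto simp: less_le)

lemma closed_nonneg_orthant: "closed (nonneg_orthant :: (real ^ 'n::finite) set)"
  unfolding nonneg_orthant_def
  by (intro closed_Collect_all closed_Collect_le continuous_intros)

lemma scaleR_nonneg_orthant: "v \<in> nonneg_orthant \<Longrightarrow> 0 \<le> r \<Longrightarrow> r *\<^sub>R v \<in> nonneg_orthant"
  by (auto simp: nonneg_orthant_def)

lemma matrix_vector_nonneg_orthant:
  "(\<And>r c. 0 \<le> B $ r $ c) \<Longrightarrow> v \<in> nonneg_orthant \<Longrightarrow> B *v v \<in> nonneg_orthant"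
  by (auto simp: nonneg_orthant_def matrix_vector_mult_def intro!: sum_nonneg)

lemma sets_nonneg_orthant [measurable]: "nonneg_orthant \<in> sets borel"
  using closed_nonneg_orthant by (rule borel_closed)

lemma sets_subcone:
  assumes i: "i \<in> {1..CARD('n)}"
  shows "(subcone i :: (real ^ 'n::finite) set) \<in> sets borel"
proof -
  note measurable_ord_stat[OF i, measurable]
  show ?thesis unfolding subcone_eq[OF i] by measurable
qed

text \<open>For \<open>x\<close> in the orthant, setting all components that do not exceed \<open>ord_stat x i\<close> to zero
  gives a point of the cone at distance at most \<open>ord_stat x i\<close>, while \<open>ord_stat _ i\<close> is
  1-Lipschitz. So \<open>ord_stat x i\<close> is exactly the distance to the cone.\<close>

lemma bounded_away_iff:
  fixes S :: "(real ^ 'n::finite) set"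
  assumes i: "i \<in> {1..CARD('n)}" and S: "S \<subseteq> nonneg_orthant"
  shows "bounded_away S (coord_cone (i - 1)) \<longleftrightarrow> (\<exists>a>0. \<forall>x\<in>S. a \<le> ord_stat x i)"
proof
  assume "bounded_away S (coord_cone (i - 1))"
  then have "0 < (INF (x, y)\<in>S \<times> coord_cone (i - 1). ereal (infnorm (x - y)))"
    by (simp add: bounded_away_def)
  \<comment> \<open>The infimum is infinity when \<open>S\<close> is empty, so a real number
    strictly below it is chosen.\<close>
  then obtain a where a: "0 < ereal a"
    and le: "ereal a < (INF (x, y)\<in>S \<times> coord_cone (i - 1). ereal (infnorm (x - y)))"
    using ereal_dense2 by blast
  have "a \<le> ord_stat x i" if x: "x \<in> S" for x
  proof -
    define y :: "real ^ 'n" where "y = (\<chi> l. if ord_stat x i < x $ l then x $ l else 0)"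
    have x0: "x \<in> nonneg_orthant" using x S by auto
    have y0: "y \<in> nonneg_orthant" using x0 by (auto simp: nonneg_orthant_def y_def)
    have "ord_stat y i \<le> 0"
    proof (rule ccontr)
      assume "\<not> ord_stat y i \<le> 0"
      then have pos: "0 < ord_stat y i" by simp
      let ?L = "{l. ord_stat y i \<le> y $ l}"
      have i_le: "i \<le> card ?L" using le_ord_stat_iff[OF i] by blast
      have gt: "ord_stat x i < x $ l" if "l \<in> ?L" for l
        using that pos by (auto simp: y_def split: if_splits)
      have "0 < card ?L" using i_le i by simp
      then have ne: "?L \<noteq> {}" using card_gt_0_iff by blast
      \<comment> \<open>At least \<open>i\<close> entries of \<open>x\<close> exceed
        \<open>ord_stat x i\<close>. Their minimum \<open>c\<close> still exceeds it strictly,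
        whereas counting the entries above \<open>c\<close> gives the opposite inequality.\<close>
      define c where "c = Min ((\<lambda>l. x $ l) ` ?L)"
      have "c \<in> (\<lambda>l. x $ l) ` ?L" unfolding c_def using ne by (intro Min_in) auto
      then have "ord_stat x i < c" using gt by auto
      moreover have "?L \<subseteq> {l. c \<le> x $ l}" by (auto simp: c_def)
      then have "i \<le> card {l. c \<le> x $ l}"
        using i_le card_mono[of "{l. c \<le> x $ l}" ?L] by simp
      then have "c \<le> ord_stat x i" using le_ord_stat_iff[OF i] by blast
      ultimately show False by simp
    qed
    with ord_stat_nonneg[OF i y0] y0 have "y \<in> coord_cone (i - 1)"
      unfolding coord_cone_eq[OF i] by simp
    with x have "(x, y) \<in> S \<times> coord_cone (i - 1)" by simp
    then have "(INF (x, y)\<in>S \<times> coord_cone (i - 1). ereal (infnorm (x - y))) \<le> ereal (infnorm (x - y))"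
      using INF_lower[of "(x, y)" _ "\<lambda>(x, y). ereal (infnorm (x - y))"] by simp
    with le have "ereal a < ereal (infnorm (x - y))" by (rule less_le_trans)
    moreover have "infnorm (x - y) \<le> ord_stat x i"
      unfolding infnorm_cart Setcompr_eq_image using x0 ord_stat_nonneg[OF i x0]
      by (intro cSUP_least) (auto simp: y_def nonneg_orthant_def)
    ultimately show ?thesis by simp
  qed
  with a show "\<exists>a>0. \<forall>x\<in>S. a \<le> ord_stat x i" by auto
next
  assume "\<exists>a>0. \<forall>x\<in>S. a \<le> ord_stat x i"
  then obtain a where a: "0 < a" and le: "\<And>x. x \<in> S \<Longrightarrow> a \<le> ord_stat x i" by auto
  have "a \<le> infnorm (x - y)" if "x \<in> S" "y \<in> coord_cone (i - 1)" for x y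
    using abs_ord_stat_diff_le_infnorm[OF i, of x y] le[OF that(1)] that(2)
    unfolding coord_cone_eq[OF i] by auto
  then have "ereal a \<le> (INF (x, y)\<in>S \<times> coord_cone (i - 1). ereal (infnorm (x - y)))"
    by (intro INF_greatest) auto
  moreover have "0 < ereal a" using a by simp
  ultimately show "bounded_away S (coord_cone (i - 1))"
    unfolding bounded_away_def by (rule less_le_trans[rotated])
qed

text \<open>Members of \<open>M_test i\<close> extended by zero are continuous on the whole orthant; \<open>a\<close> is a lower
  bound for the distance of the support to the cone.\<close>

definition test_fun :: "nat \<Rightarrow> real \<Rightarrow> real \<Rightarrow> (real ^ 'n::finite \<Rightarrow> real) \<Rightarrow> bool" where
  "test_fun i a M F \<longleftrightarrow> 0 < a \<and> 0 \<le> M \<and> continuous_on nonneg_orthant F \<and>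
     (\<forall>z\<in>nonneg_orthant. \<bar>F z\<bar> \<le> M \<and> (F z \<noteq> 0 \<longrightarrow> a \<le> ord_stat z i))"

lemma test_funD:
  assumes "test_fun i a M F"
  shows "0 < a" "0 \<le> M" "continuous_on nonneg_orthant F"
    and "\<And>z. z \<in> nonneg_orthant \<Longrightarrow> \<bar>F z\<bar> \<le> M"
    and "\<And>z. z \<in> nonneg_orthant \<Longrightarrow> F z \<noteq> 0 \<Longrightarrow> a \<le> ord_stat z i"
    and "\<And>z. z \<in> nonneg_orthant \<Longrightarrow> ord_stat z i < a \<Longrightarrow> F z = 0"
  using assms by (auto simp: test_fun_def not_le[symmetric])

text \<open>The bound \<open>a\<close> survives the closure in \<open>M_test\<close>, since the
  superlevel sets of \<open>ord_stat\<close> are closed.\<close>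

lemma M_test_of_test_fun:
  fixes F :: "real ^ 'n::finite \<Rightarrow> real"
  assumes i: "i \<in> {1..CARD('n)}" and F: "test_fun i a M F"
  shows "F \<in> M_test i"
proof -
  note F = test_funD[OF F]
  have sub: "subcone i \<subseteq> (nonneg_orthant :: (real ^ 'n) set)" by (auto simp: subcone_def)
  have "continuous_on (subcone i) F" using F(3) sub by (rule continuous_on_subset)
  moreover have "bounded (F ` subcone i)"
    using F(4) sub by (intro boundedI[of _ M]) auto
  moreover have "closure {x \<in> subcone i. F x \<noteq> 0} \<subseteq> {x. a \<le> ord_stat x i}"
    using F(5) sub
    by (intro closure_minimal closed_Collect_le continuous_on_ord_stat[OF i] continuous_on_const) auto
  then have "bounded_away (subcone i \<inter> closure {x \<in> subcone i. F x \<noteq> 0}) (coord_cone (i - 1))"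
    using F(1) sub by (subst bounded_away_iff[OF i]) (blast, blast)
  ultimately show ?thesis by (simp add: M_test_def)
qed

text \<open>Two relatively open sets cover the orthant: the points with
  \<open>ord_stat z i < a\<close>, where the extension is 0, and the subcone, where it is
  \<open>f\<close>. Continuity on both pieces gives continuity on the union.\<close>

lemma test_fun_of_M_test:
  fixes f :: "real ^ 'n::finite \<Rightarrow> real"
  assumes i: "i \<in> {1..CARD('n)}" and f: "f \<in> M_test i"
  obtains a M where "test_fun i a M (\<lambda>z. if z \<in> subcone i then f z else 0)"
proof -
  let ?F = "\<lambda>z. if z \<in> subcone i then f z else 0"
  have sub: "subcone i \<subseteq> (nonneg_orthant :: (real ^ 'n) set)" by (auto simp: subcone_def)
  have "bounded (f ` subcone i)" using f by (simp add: M_test_def)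
  then obtain M where M: "\<And>z. z \<in> subcone i \<Longrightarrow> \<bar>f z\<bar> \<le> M" and "0 < M"
    by (auto simp: bounded_pos)
  from f have "bounded_away (subcone i \<inter> closure {x \<in> subcone i. f x \<noteq> 0}) (coord_cone (i - 1))"
    and cont: "continuous_on (subcone i) f"
    by (auto simp: M_test_def)
  then obtain a where a: "0 < a"
    and le: "\<And>x. x \<in> subcone i \<inter> closure {x \<in> subcone i. f x \<noteq> 0} \<Longrightarrow> a \<le> ord_stat x i"
    using sub by (subst (asm) bounded_away_iff[OF i]) auto
  have le': "a \<le> ord_stat x i" if "x \<in> subcone i" "f x \<noteq> 0" for x
    using that by (intro le IntI subsetD[OF closure_subset]) auto
  let ?S = "nonneg_orthant \<inter> {z :: real ^ 'n. ord_stat z i < a}"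
  have eq: "?S \<union> subcone i = (nonneg_orthant :: (real ^ 'n) set)"
    using ord_stat_nonneg[OF i] a by (force simp: subcone_eq[OF i])
  have "openin (top_of_set (?S \<union> subcone i)) ?S"
    unfolding eq by (intro openin_open_Int open_Collect_less continuous_on_ord_stat[OF i]
        continuous_on_const)
  moreover have "subcone i = nonneg_orthant \<inter> {z :: real ^ 'n. 0 < ord_stat z i}"
    using subcone_eq[OF i] by auto
  then have "openin (top_of_set (?S \<union> subcone i)) (subcone i)"
    unfolding eq by (simp add: openin_open_Int open_Collect_less continuous_on_ord_stat[OF i])
  moreover have "continuous_on ?S ?F"
    using le' by (subst continuous_on_cong[OF refl, of _ _ "\<lambda>_. 0"]) (force, simp)
  moreover have "continuous_on (subcone i) ?F"
    using cont by (subst continuous_on_cong[OF refl, of _ _ f]) auto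
  ultimately have "continuous_on (?S \<union> subcone i) ?F"
    by (rule continuous_on_Un_local_open)
  then have "test_fun i a M ?F"
    unfolding eq using a M \<open>0 < M\<close> le' by (auto simp: test_fun_def)
  then show ?thesis by (rule that)
qed

section \<open>The tail of a regularly varying vector\<close>

locale mrv_vector = prob_space P for P :: "'w measure" +
  fixes Z :: "'w \<Rightarrow> real ^ 'd::finite" and \<alpha> :: real and \<mu> :: "(real ^ 'd) measure" and i :: nat
  assumes i: "i \<in> {1..CARD('d)}"
    and Z_measurable [measurable]: "Z \<in> borel_measurable P"
    and Z_nonneg: "\<And>\<omega>. \<omega> \<in> space P \<Longrightarrow> Z \<omega> \<in> nonneg_orthant"
    and mrv: "MRV P Z \<alpha> (canonical_scaling P Z i) \<mu> i"
begin

abbreviation b :: "real \<Rightarrow> real" where "b \<equiv> canonical_scaling P Z i"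

definition U :: "real \<Rightarrow> real" where "U x = prob {\<omega> \<in> space P. x < ord_stat (Z \<omega>) i}"

lemma ord_stat_Z_measurable [measurable]: "(\<lambda>\<omega>. ord_stat (Z \<omega>) i) \<in> borel_measurable P"
  using measurable_compose[OF Z_measurable measurable_ord_stat[OF i]] .

lemma ord_stat_Z_nonneg: "\<omega> \<in> space P \<Longrightarrow> 0 \<le> ord_stat (Z \<omega>) i"
  using Z_nonneg ord_stat_nonneg[OF i] by blast

lemma \<alpha>_pos: "0 < \<alpha>"
  using mrv by (simp add: MRV_def)

lemma b_ratio: "0 < c \<Longrightarrow> ((\<lambda>t. b (t * c) / b t) \<longlongrightarrow> c powr (1 / \<alpha>)) at_top"
  using mrv by (auto simp: MRV_def regularly_varying_def)

lemma U_nonneg: "0 \<le> U x" and U_le_1: "U x \<le> 1"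
  by (simp_all add: U_def)

lemma U_antimono: "x \<le> y \<Longrightarrow> U y \<le> U x"
  unfolding U_def by (intro finite_measure_mono) auto

lemma U_neg: "x < 0 \<Longrightarrow> U x = 1"
  unfolding U_def using ord_stat_Z_nonneg
  by (subst prob_eq_1) (auto intro!: AE_I2 less_le_trans[of x 0])

lemma cdf_eq: "cdf (distr P borel (\<lambda>\<omega>. ord_stat (Z \<omega>) i)) x = 1 - U x"
proof -
  have "space P - {\<omega> \<in> space P. x < ord_stat (Z \<omega>) i}
      = (\<lambda>\<omega>. ord_stat (Z \<omega>) i) -` {..x} \<inter> space P" by auto
  moreover have "prob (space P - {\<omega> \<in> space P. x < ord_stat (Z \<omega>) i}) = 1 - U x"
    unfolding U_def by (rule prob_compl) measurable
  ultimately show ?thesis by (simp add: cdf_def measure_distr)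
qed

lemma U_tendsto_0: "(U \<longlongrightarrow> 0) at_top"
proof -
  interpret D: real_distribution "distr P borel (\<lambda>\<omega>. ord_stat (Z \<omega>) i)"
    by standard (auto intro!: prob_space.prob_space prob_space_distr)
  have "((\<lambda>x. 1 - U x) \<longlongrightarrow> 1) at_top"
    using D.cdf_lim_at_top_prob unfolding cdf_eq[abs_def] .
  from tendsto_diff[OF tendsto_const[of 1] this] show ?thesis by simp
qed

section \<open>The canonical scaling as left inverse of the tail\<close>

lemma b_eq: "b t = Inf {x. U x \<le> 1 / t}"
  by (simp add: canonical_scaling_def left_inverse_def cdf_eq)

text \<open>Together with \<open>le_b\<close> this replaces the identity
  \<open>U (b t) = 1 / t\<close>, which can fail at jumps of \<open>U\<close>. The condition
  \<open>1 < t\<close> bounds the set in the infimum below by 0, since \<open>U\<close> is 1 at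
  negative arguments.\<close>

lemma b_le:
  assumes "1 < t" "U x \<le> 1 / t"
  shows "b t \<le> x"
  unfolding b_eq
proof (rule cInf_lower)
  have "0 \<le> y" if "U y \<le> 1 / t" for y
    using that U_neg[of y] assms by (force simp: field_simps not_le)
  then show "bdd_below {x. U x \<le> 1 / t}" by (intro bdd_belowI[of _ 0]) auto
qed (use assms in simp)

lemma le_b:
  assumes "1 < t" "1 / t < U x"
  shows "x \<le> b t"
proof (rule ccontr)
  assume "\<not> x \<le> b t"
  then have less: "Inf {x. U x \<le> 1 / t} < x" by (simp add: b_eq)
  have "eventually (\<lambda>x. U x < 1 / t) at_top"
    using order_tendstoD(2)[OF U_tendsto_0, of "1 / t"] assms by simp
  then obtain x0 where "U x0 < 1 / t" by (auto simp: eventually_at_top_linorder)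
  then have "{x. U x \<le> 1 / t} \<noteq> {}" by (auto intro: less_imp_le)
  then obtain y where "U y \<le> 1 / t" "y < x" using cInf_lessD[OF _ less] by auto
  with U_antimono[of y x] assms show False by simp
qed

lemma b_nonneg_eventually: "\<forall>\<^sub>F t in at_top. 0 \<le> b t"
  using mrv by (simp add: MRV_def regularly_varying_def)

text \<open>Positivity comes from the convention for division by zero: if \<open>b t = 0\<close>,
  the quotient would be 0 and could not exceed \<open>m \<ge> 0\<close>. The case
  \<open>c = 1\<close>, \<open>m = 0\<close> is \<open>b_pos\<close>.\<close>

lemma b_growth: 
  assumes "0 < c" "0 \<le> m" "m < c powr (1 / \<alpha>)"
  shows "\<forall>\<^sub>F t in at_top. 0 < b t \<and> m * b t < b (t * c)"
  using order_tendstoD(1)[OF b_ratio[OF assms(1)] assms(3)] b_nonneg_eventually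
proof eventually_elim
  case (elim t)
  then have "b t \<noteq> 0" using assms(2) by (intro notI) simp
  with elim have "0 < b t" by simp
  with elim show ?case by (simp add: pos_less_divide_eq)
qed

lemma b_pos: "\<forall>\<^sub>F t in at_top. 0 < b t"
  using b_growth[of 1 0] by (auto elim: eventually_mono)

text \<open>Doubling the argument eventually multiplies \<open>b\<close> by more than a fixed
  \<open>m > 1\<close>, where \<open>m\<close> is the midpoint between 1 and
  \<open>2 powr (1 / \<alpha>)\<close>; iterating gives geometric growth.\<close>

lemma b_unbounded: "\<exists>t>1. s < b t"
proof -
  define m where "m = (1 + 2 powr (1 / \<alpha>)) / 2"
  have "1 < 2 powr (1 / \<alpha>)" using \<alpha>_pos by simp
  then have m: "1 < m" "m < 2 powr (1 / \<alpha>)" by (auto simp: m_def)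
  then have "\<forall>\<^sub>F t in at_top. 1 < t \<and> 0 < b t \<and> m * b t < b (t * 2)"
    using m by (intro eventually_conj[OF eventually_gt_at_top] b_growth) auto
  then obtain T where T: "\<And>t. T \<le> t \<Longrightarrow> 1 < t \<and> 0 < b t \<and> m * b t < b (t * 2)"
    by (auto simp: eventually_at_top_linorder)
  have T1: "1 < T" using T[of T] by simp
  have le: "T \<le> T * 2 ^ n" for n using T1 by simp
  have "m ^ n * b T \<le> b (T * 2 ^ n)" for n
  proof (induction n)
    case (Suc n)
    have "m ^ Suc n * b T = m * (m ^ n * b T)" by simp
    also have "\<dots> \<le> m * b (T * 2 ^ n)" using Suc m by simp
    also have "\<dots> \<le> b (T * 2 ^ n * 2)" using T[OF le[of n]] by simp
    finally show ?case by (simp add: mult_ac)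
  qed simp
  moreover obtain n where "s / b T < m ^ n" using real_arch_pow[OF m(1)] by blast
  then have "s < m ^ n * b T" using T[of T] by (simp add: pos_divide_less_eq)
  ultimately have "s < b (T * 2 ^ n)" by (rule less_le_trans[rotated])
  moreover have "1 < T * 2 ^ n" using le[of n] T1 by linarith
  ultimately show ?thesis by blast
qed

text \<open>If \<open>U s\<close> were 0, then \<open>s\<close> would bound \<open>b t\<close> for
  every \<open>t > 1\<close>. Positivity is what makes the substitution \<open>t = 1 / U s\<close>
  and the division by the tail meaningful.\<close>

lemma U_pos: "0 < U s"
proof (rule ccontr)
  assume "\<not> 0 < U s"
  then have "U s = 0" using U_nonneg[of s] by simp
  moreover obtain t where "1 < t" "s < b t" using b_unbounded by blast
  ultimately show False using b_le[of t s] by simp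
qed

lemma inverse_U_at_top: "filterlim (\<lambda>s. 1 / U s) at_top at_top"
  using filterlim_inverse_at_top[OF U_tendsto_0] U_pos by (simp add: inverse_eq_divide)

text \<open>With \<open>t = 1 / U s\<close>, \<open>b_le\<close> gives \<open>b t \<le> s\<close>
  directly. In the other direction \<open>1 / (t * c) < U s\<close> for every \<open>c > 1\<close>,
  hence \<open>s \<le> b (t * c)\<close>, and regular variation compares this with
  \<open>b t\<close>.\<close>

lemma div_b_tendsto_1: "((\<lambda>s. s / b (1 / U s)) \<longlongrightarrow> 1) at_top"
proof (rule order_tendstoI)
  have ev: "\<forall>\<^sub>F s in at_top. 1 < 1 / U s \<and> 0 < b (1 / U s)"
    using filterlim_at_top_dense[THEN iffD1, OF inverse_U_at_top, rule_format, of 1]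
      eventually_compose_filterlim[OF b_pos inverse_U_at_top]
    by eventually_elim simp
  show "\<forall>\<^sub>F s in at_top. a < s / b (1 / U s)" if "a < 1" for a
    using ev
  proof eventually_elim
    case (elim s)
    have "b (1 / U s) \<le> s" using elim by (intro b_le) auto
    then have "1 \<le> s / b (1 / U s)" using elim by simp
    with that show ?case by simp
  qed
  fix a :: real assume a: "1 < a"
  \<comment> \<open>Chosen so that the limiting ratio \<open>c powr (1 / \<alpha>)\<close> is the
    midpoint of 1 and \<open>a\<close>.\<close>
  define c where "c = ((1 + a) / 2) powr \<alpha>"
  have c: "1 < c" "c powr (1 / \<alpha>) < a"
    using a \<alpha>_pos by (auto simp: c_def powr_powr)
  have "\<forall>\<^sub>F t in at_top. b (t * c) / b t < a"
    using c by (intro order_tendstoD(2)[OF b_ratio]) auto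
  from ev eventually_compose_filterlim[OF this inverse_U_at_top]
  show "\<forall>\<^sub>F s in at_top. s / b (1 / U s) < a"
  proof eventually_elim
    case (elim s)
    have "1 < 1 / U s * c" using elim c by (metis less_1_mult)
    then have "s \<le> b (1 / U s * c)"
      using c U_pos[of s] by (intro le_b) (auto simp: field_simps)
    then have "s / b (1 / U s) \<le> b (1 / U s * c) / b (1 / U s)"
      using elim by (intro divide_right_mono) auto
    with elim show ?case by linarith
  qed
qed

text \<open>If it failed at a large \<open>s\<close>, then with \<open>t = 1 / U s\<close> the tail
  at \<open>2 * s\<close> would be below \<open>1 / (t * \<rho> * c)\<close>, so
  \<open>b (t * \<rho> * c) \<le> 2 * s\<close>. But \<open>s \<le> b (t * \<rho>)\<close>, and
  \<open>b\<close> more than doubles when its argument is multiplied by \<open>c\<close>.\<close>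

lemma U_doubling:
  assumes p: "\<alpha> < p"
  shows "\<forall>\<^sub>F s in at_top. U s \<le> 2 powr p * U (2 * s)"
proof -
  \<comment> \<open>The slack \<open>p - \<alpha>\<close> is halved: \<open>\<rho> > 1\<close>
    provides the strict inequality that \<open>le_b\<close> requires, and the exponent of
    \<open>c\<close> still exceeds \<alpha>, so that
    \<open>c powr (1 / \<alpha>) > 2\<close>.\<close>
  define \<rho> where "\<rho> = (2 :: real) powr ((p - \<alpha>) / 2)"
  define c where "c = (2 :: real) powr ((p + \<alpha>) / 2)"
  have \<rho>: "1 < \<rho>" using p by (simp add: \<rho>_def)
  have c: "1 < c" using p \<alpha>_pos by (simp add: c_def)
  have prod: "\<rho> * c = 2 powr p" by (simp add: \<rho>_def c_def field_simps flip: powr_add)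
  have "1 < (p + \<alpha>) / 2 * (1 / \<alpha>)" using p \<alpha>_pos by (simp add: field_simps)
  then have "2 powr 1 < 2 powr ((p + \<alpha>) / 2 * (1 / \<alpha>))" by (subst powr_less_cancel_iff) auto
  then have "2 < c powr (1 / \<alpha>)" by (simp add: c_def powr_powr)
  then have "\<forall>\<^sub>F t in at_top. 0 < b t \<and> 2 * b t < b (t * c)"
    using c by (intro b_growth) auto
  moreover have lim: "filterlim (\<lambda>s. 1 / U s * \<rho>) at_top at_top"
    using \<rho> by (intro filterlim_at_top_mult_tendsto_pos[OF tendsto_const _ inverse_U_at_top]) simp
  ultimately have "\<forall>\<^sub>F s in at_top. 0 < b (1 / U s * \<rho>) \<and> 2 * b (1 / U s * \<rho>) < b (1 / U s * \<rho> * c)"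
    by (rule eventually_compose_filterlim)
  moreover have "\<forall>\<^sub>F s in at_top. 1 < 1 / U s"
    using filterlim_at_top_dense[THEN iffD1, OF inverse_U_at_top] by blast
  ultimately show ?thesis
  proof eventually_elim
    case (elim s)
    show ?case
    proof (rule ccontr)
      assume "\<not> ?thesis"
      then have less: "2 powr p * U (2 * s) < U s" by simp
      have "1 < 1 / U s * \<rho>" using elim \<rho> by (metis less_1_mult)
      moreover have "1 < 1 / U s * \<rho> * c" using calculation c by (metis less_1_mult)
      moreover have "U (2 * s) \<le> 1 / (1 / U s * \<rho> * c)"
        using less U_pos[of s] \<rho> c by (simp add: field_simps flip: prod)
      ultimately have "b (1 / U s * \<rho> * c) \<le> 2 * s" and "s \<le> b (1 / U s * \<rho>)"
        using \<rho> U_pos[of s] by (auto intro!: b_le le_b simp: field_simps)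
      with elim show False by simp
    qed
  qed
qed

text \<open>Below the threshold \<open>t0\<close> the trivial bound \<open>U \<le> 1\<close> suffices, because
  \<open>t / x < t0\<close> forces \<open>x\<close> to be of order \<open>t\<close>.\<close>

lemma potter:
  assumes p: "\<alpha> < p"
  shows "\<exists>C t0. 0 < t0 \<and> 0 \<le> C \<and> (\<forall>t\<ge>t0. \<forall>x\<ge>1. U (t / x) \<le> C * x powr p * U t)"
proof -
  have p0: "0 < p" using p \<alpha>_pos by simp
  have "\<forall>\<^sub>F s in at_top. 0 < s \<and> U s \<le> 2 powr p * U (2 * s)"
    using U_doubling[OF p] eventually_gt_at_top[of "0 :: real"] by eventually_elim simp
  then obtain t0 where t0: "\<And>s. t0 \<le> s \<Longrightarrow> 0 < s \<and> U s \<le> 2 powr p * U (2 * s)"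
    by (auto simp: eventually_at_top_linorder)
  then have t0_pos: "0 < t0" by blast
  have iter: "U s \<le> (2 powr p) ^ n * U (2 ^ n * s)" if s: "t0 \<le> s" for s n
  proof (induction n)
    case (Suc n)
    have "t0 \<le> 2 ^ n * s"
      using s t0_pos mult_mono[of 1 "2 ^ n" t0 s] by simp
    then have "(2 powr p) ^ n * U (2 ^ n * s) \<le> (2 powr p) ^ n * (2 powr p * U (2 * (2 ^ n * s)))"
      using t0 by (intro mult_left_mono) auto
    with Suc have "U s \<le> (2 powr p) ^ n * (2 powr p * U (2 * (2 ^ n * s)))" by (rule order_trans)
    then show ?case by (simp add: mult_ac)
  qed simp
  have large: "U s \<le> 2 powr p * x powr p * U (x * s)" if s: "t0 \<le> s" and x: "1 \<le> x" for s x
  proof -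
    \<comment> \<open>Rounding the logarithm up gives \<open>x \<le> 2 ^ n \<le> 2 * x\<close>; the
      lost factor 2 is the source of \<open>2 powr p\<close> in the constant.\<close>
    define n where "n = nat \<lceil>log 2 x\<rceil>"
    have l0: "0 \<le> log 2 x" using x by simp
    have "x = 2 powr log 2 x" using x by simp
    also have "\<dots> \<le> 2 powr real n" unfolding n_def using l0 by (intro powr_mono) linarith+
    finally have x_le: "x \<le> 2 ^ n" by (simp add: powr_realpow)
    have "(2 :: real) ^ n = 2 powr real n" by (simp add: powr_realpow)
    also have "\<dots> \<le> 2 powr (log 2 x + 1)" unfolding n_def using l0 by (intro powr_mono) linarith+
    also have "\<dots> = 2 * x" using x by (simp add: powr_add)
    finally have n_le: "2 ^ n \<le> 2 * x" .
    have "U s \<le> (2 powr p) ^ n * U (2 ^ n * s)" by (rule iter[OF s])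
    also have "(2 powr p) ^ n = (2 ^ n) powr p" by (simp add: powr_power powr_realpow[symmetric] powr_powr mult.commute)
    also have "(2 ^ n) powr p * U (2 ^ n * s) \<le> (2 * x) powr p * U (x * s)"
      using x_le n_le p0 s t0_pos U_nonneg
      by (intro mult_mono powr_mono2 U_antimono) auto
    finally show ?thesis using x by (simp add: powr_mult)
  qed
  show ?thesis
  proof (intro exI conjI allI impI)
    show "0 < t0" by (rule t0_pos)
    \<comment> \<open>Since \<open>U t0 \<le> 1\<close>, dividing by it only enlarges the constant
      \<open>2 powr p\<close> that suffices for large arguments. The remaining case needs the
      division, because there the left side is only known to be at most 1.\<close>
    show "0 \<le> 2 powr p / U t0" using U_nonneg by simp
    fix t x :: real assume t: "t0 \<le> t" and x: "1 \<le> x"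
    show "U (t / x) \<le> 2 powr p / U t0 * x powr p * U t"
    proof (cases "t0 \<le> t / x")
      case True
      have "U (t / x) \<le> 2 powr p * x powr p * U t" using large[OF True x] x by simp
      also have "\<dots> \<le> 2 powr p / U t0 * x powr p * U t"
        using U_nonneg U_le_1[of t0] U_pos[of t0]
        by (intro mult_right_mono) (auto simp: field_simps intro!: mult_left_le)
      finally show ?thesis .
    next
      case False
      then have tx: "t / t0 \<le> x" using t0_pos x by (simp add: field_simps)
      have "U t0 \<le> 2 powr p * (t / t0) powr p * U (t / t0 * t0)"
        using t t0_pos by (intro large) auto
      also have "\<dots> \<le> 2 powr p * x powr p * U t"
        using tx t t0_pos p0 U_nonneg by (intro mult_mono powr_mono2) auto
      finally have "1 \<le> 2 powr p / U t0 * x powr p * U t"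
        using U_pos[of t0] by (simp add: field_simps)
      with U_le_1[of "t / x"] show ?thesis by linarith
    qed
  qed
qed

end

section \<open>Convergence along the tail\<close>

lemma
  fixes \<mu> :: "(real ^ 'n::finite) measure"
  assumes i: "i \<in> {1..CARD('n)}" and sets: "sets \<mu> = sets (subcone_borel i)"
  shows space_subcone_borel: "space \<mu> = subcone i"
    and sets_ord_stat_ge: "{z \<in> subcone i. a \<le> ord_stat z i} \<in> sets \<mu>"
    and measurable_subcone: "continuous_on (subcone i) f \<Longrightarrow> (f :: _ \<Rightarrow> real) \<in> borel_measurable \<mu>"
    and measurable_subcone_ident: "(\<lambda>z. z) \<in> borel_measurable \<mu>"
proof -
  note measurable_ord_stat[OF i, measurable] sets_subcone[OF i, measurable]
  show sp: "space \<mu> = subcone i"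
    using sets_eq_imp_space_eq[OF sets] by (simp add: subcone_borel_def space_restrict_space)
  have "{z \<in> subcone i. a \<le> ord_stat z i} \<in> sets (restrict_space borel (subcone i :: (real ^ 'n) set))"
    by (subst sets_restrict_space_iff) auto
  then show "{z \<in> subcone i. a \<le> ord_stat z i} \<in> sets \<mu>"
    by (simp add: sets subcone_borel_def)
  show "f \<in> borel_measurable \<mu>" if "continuous_on (subcone i) f"
    using borel_measurable_continuous_on_restrict[OF that]
    by (simp add: measurable_cong_sets[OF sets refl] subcone_borel_def)
  show "(\<lambda>z. z) \<in> borel_measurable \<mu>"
    by (simp add: measurable_cong_sets[OF sets refl] subcone_borel_def measurable_restrict_space1)
qed

lemma M_class_finite:
  fixes \<mu> :: "(real ^ 'n::finite) measure"
  assumes i: "i \<in> {1..CARD('n)}" and \<mu>: "\<mu> \<in> M_class i" and a: "0 < a"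
  shows "emeasure \<mu> {z \<in> subcone i. a \<le> ord_stat z i} < \<infinity>"
proof -
  have "bounded_away {z \<in> subcone i. a \<le> ord_stat z i} (coord_cone (i - 1) :: (real ^ 'n) set)"
    using a by (subst bounded_away_iff[OF i]) (auto simp: subcone_def)
  then show ?thesis
    using \<mu> sets_ord_stat_ge[OF i, of \<mu> a] unfolding M_class_def by blast
qed

text \<open>Every set bounded away from the cone lies in a superlevel set of
  \<open>ord_stat\<close>, so finiteness has to be checked only there.\<close>

lemma M_classI:
  fixes \<mu> :: "(real ^ 'n::finite) measure"
  assumes i: "i \<in> {1..CARD('n)}" and sets: "sets \<mu> = sets (subcone_borel i)"
    and fin: "\<And>a. 0 < a \<Longrightarrow> emeasure \<mu> {z \<in> subcone i. a \<le> ord_stat z i} < \<infinity>"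
  shows "\<mu> \<in> M_class i"
proof -
  have "emeasure \<mu> S < \<infinity>" if S: "S \<in> sets \<mu>" and ba: "bounded_away S (coord_cone (i - 1))" for S
  proof -
    have sub: "S \<subseteq> subcone i" using sets.sets_into_space[OF S] space_subcone_borel[OF i sets] by simp
    then have "S \<subseteq> nonneg_orthant" by (auto simp: subcone_def)
    from ba[unfolded bounded_away_iff[OF i this]] obtain a
      where a: "0 < a" "\<And>x. x \<in> S \<Longrightarrow> a \<le> ord_stat x i" by auto
    have "emeasure \<mu> S \<le> emeasure \<mu> {z \<in> subcone i. a \<le> ord_stat z i}"
      using a sub by (intro emeasure_mono sets_ord_stat_ge[OF i sets]) auto
    also have "\<dots> < \<infinity>" by (rule fin[OF a(1)])
    finally show ?thesis .
  qed
  with sets show ?thesis by (auto simp: M_class_def)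
qed

text \<open>The superlevel sets of \<open>ord_stat\<close> at \<open>1 / (n + 1)\<close> exhaust the
  subcone. Sigma-finiteness is needed for the product with \<open>\<mu>\<close> and for
  Fubini.\<close>

lemma sigma_finite_M_class:
  fixes \<mu> :: "(real ^ 'n::finite) measure"
  assumes i: "i \<in> {1..CARD('n)}" and \<mu>: "\<mu> \<in> M_class i"
  shows "sigma_finite_measure \<mu>"
proof
  have sets: "sets \<mu> = sets (subcone_borel i)" using \<mu> by (simp add: M_class_def)
  define A where "A n = {z \<in> subcone i :: (real ^ 'n) set. 1 / real (Suc n) \<le> ord_stat z i}" for n
  have "A n \<in> sets \<mu>" "emeasure \<mu> (A n) \<noteq> \<infinity>" for n
    unfolding A_def using sets_ord_stat_ge[OF i sets] M_class_finite[OF i \<mu>, of "1 / real (Suc n)"]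
    by auto
  moreover have "z \<in> (\<Union>n. A n)" if "z \<in> subcone i" for z
  proof -
    have "0 < ord_stat z i" using that by (simp add: subcone_eq[OF i])
    then obtain n where "inverse (real (Suc n)) < ord_stat z i" using reals_Archimedean by blast
    with that show ?thesis by (auto simp: A_def inverse_eq_divide intro: less_imp_le)
  qed
  then have "(\<Union>n. A n) = space \<mu>" unfolding space_subcone_borel[OF i sets] by (auto simp: A_def)
  ultimately show "\<exists>A. countable A \<and> A \<subseteq> sets \<mu> \<and> \<Union> A = space \<mu> \<and> (\<forall>a\<in>A. emeasure \<mu> a \<noteq> \<infinity>)"
    by (intro exI[of _ "range A"]) auto
qed

lemma test_fun_integrable:
  fixes F :: "real ^ 'n::finite \<Rightarrow> real"
  assumes i: "i \<in> {1..CARD('n)}" and \<mu>: "\<mu> \<in> M_class i" and F: "test_fun i a M F"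
  shows "integrable \<mu> F"
proof -
  have sets: "sets \<mu> = sets (subcone_borel i)" using \<mu> by (simp add: M_class_def)
  note F = test_funD[OF F]
  have sub: "subcone i \<subseteq> (nonneg_orthant :: (real ^ 'n) set)" by (auto simp: subcone_def)
  show ?thesis
  proof (rule integrableI_bounded_set[where A = "{z \<in> subcone i. a \<le> ord_stat z i}" and B = M])
    show "F \<in> borel_measurable \<mu>"
      by (rule measurable_subcone[OF i sets continuous_on_subset[OF F(3) sub]])
    show "AE z in \<mu>. z \<in> {z \<in> subcone i. a \<le> ord_stat z i} \<longrightarrow> norm (F z) \<le> M"
      using F(4) sub by (intro AE_I2) auto
    show "AE z in \<mu>. z \<notin> {z \<in> subcone i. a \<le> ord_stat z i} \<longrightarrow> F z = 0"
      using F(5) sub by (intro AE_I2) (auto simp: space_subcone_borel[OF i sets])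
  qed (use sets_ord_stat_ge[OF i sets] M_class_finite[OF i \<mu> F(1)] in auto)
qed

lemma test_fun_measurable:
  fixes F :: "real ^ 'n::finite \<Rightarrow> real"
  assumes F: "test_fun i a M F" and X: "X \<in> borel_measurable N"
    and nn: "\<And>\<omega>. \<omega> \<in> space N \<Longrightarrow> X \<omega> \<in> nonneg_orthant"
  shows "(\<lambda>\<omega>. F (X \<omega>)) \<in> borel_measurable N"
proof -
  have "X \<in> measurable N (restrict_space borel nonneg_orthant)"
    using X nn by (intro measurable_restrict_space2) auto
  moreover have "F \<in> borel_measurable (restrict_space borel nonneg_orthant)"
    using test_funD(3)[OF F] by (rule borel_measurable_continuous_on_restrict)
  ultimately show ?thesis by (rule measurable_compose)
qed

lemma scale_measure_eq_density: "scale_measure r M = density M (\<lambda>_. r)"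
  by (rule measure_eqI) (auto simp: emeasure_density_const)

text \<open>Turns the scaled and restricted image measures of \<open>MRV\<close> and
  \<open>normalised_law\<close> into expectations of functions extended by zero.\<close>

lemma integral_scaled_restricted_law:
  fixes f :: "real ^ 'n::finite \<Rightarrow> real"
  assumes i: "i \<in> {1..CARD('n)}" and f: "continuous_on (subcone i) f"
    and X [measurable]: "X \<in> borel_measurable N" and c: "0 \<le> c"
  shows "integral\<^sup>L (scale_measure (ennreal c) (restrict_space (distr N borel X) (subcone i))) f
    = c * (\<integral>\<omega>. (if X \<omega> \<in> subcone i then f (X \<omega>) else 0) \<partial>N)"
proof -
  note sets_subcone[OF i, measurable]
  have meas: "f \<in> borel_measurable (restrict_space borel (subcone i))"
    using f by (rule borel_measurable_continuous_on_restrict)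
  then have meas2 [measurable]: "(\<lambda>x. indicator (subcone i) x *\<^sub>R f x) \<in> borel_measurable borel"
    by (subst (asm) borel_measurable_restrict_space_iff) auto
  have meas3: "f \<in> borel_measurable (restrict_space (distr N borel X) (subcone i))"
    using meas by (simp cong: measurable_cong_sets sets_restrict_space_cong)
  have "integral\<^sup>L (scale_measure (ennreal c) (restrict_space (distr N borel X) (subcone i))) f
    = c * integral\<^sup>L (restrict_space (distr N borel X) (subcone i)) f"
    unfolding scale_measure_eq_density using c meas3 by (subst integral_density) auto
  also have "integral\<^sup>L (restrict_space (distr N borel X) (subcone i)) f
    = (\<integral>\<omega>. indicator (subcone i) (X \<omega>) *\<^sub>R f (X \<omega>) \<partial>N)"
    by (subst integral_restrict_space, simp, subst integral_distr[OF X meas2]) simp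
  also have "\<dots> = (\<integral>\<omega>. (if X \<omega> \<in> subcone i then f (X \<omega>) else 0) \<partial>N)"
    by (rule Bochner_Integration.integral_cong) auto
  finally show ?thesis .
qed

section \<open>Continuous cutoffs and small dilations\<close>

definition clamp01 :: "real \<Rightarrow> real" where "clamp01 x = max 0 (min 1 x)"

lemma clamp01_simps: "0 \<le> clamp01 x" "clamp01 x \<le> 1" "x \<le> 0 \<Longrightarrow> clamp01 x = 0" "1 \<le> x \<Longrightarrow> clamp01 x = 1"
  by (auto simp: clamp01_def)

lemma continuous_on_clamp01 [continuous_intros]:
  "continuous_on S g \<Longrightarrow> continuous_on S (\<lambda>x. clamp01 (g x))"
  unfolding clamp01_def by (intro continuous_intros)

text \<open>The ramp in \<open>ord_stat z i\<close> is 0 up to \<open>a / 2\<close> and 1 from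
  \<open>a\<close> on, so it dominates the indicator of a superlevel set while remaining a test
  function. The factor \<open>h\<close> allows a further localisation far from the origin.\<close>

lemma test_fun_cutoff:
  fixes h :: "real ^ 'n::finite \<Rightarrow> real"
  assumes i: "i \<in> {1..CARD('n)}" and a: "0 < a" and h: "continuous_on nonneg_orthant h"
    and bound: "\<And>z. 0 \<le> h z" "\<And>z. h z \<le> 1"
  shows "test_fun i (a / 2) 1 (\<lambda>z. clamp01 (2 * ord_stat z i / a - 1) * h z)"
proof -
  have "\<bar>clamp01 x * h z\<bar> \<le> 1" for x and z :: "real ^ 'n"
    using mult_mono[of "clamp01 x" 1 "h z" 1] clamp01_simps[of x] bound[of z]
    by (simp add: abs_mult)
  moreover have "a / 2 \<le> ord_stat z i" if "clamp01 (2 * ord_stat z i / a - 1) \<noteq> 0" for z :: "real ^ 'n"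
    using that a clamp01_simps(3)[of "2 * ord_stat z i / a - 1"]
    by (cases "a / 2 \<le> ord_stat z i") (auto simp: field_simps)
  ultimately show ?thesis
    using a h by (auto simp: test_fun_def intro!: continuous_intros continuous_on_ord_stat[OF i])
qed

text \<open>Uniform continuity on the compact part of the orthant within norm \<open>K\<close>: a
  factor \<open>r \<ge> 1\<close> keeps the shrunk point in that part and moves it by at most
  \<open>(r - 1) * K\<close>. Without such a \<open>K\<close> there would be no compactness, as
  supports may be unbounded.\<close>

lemma test_fun_dilation:
  fixes F :: "real ^ 'n::finite \<Rightarrow> real"
  assumes F: "test_fun i a M F" and e: "0 < e"
  obtains \<eta> where "0 < \<eta>"
    "\<And>z r. z \<in> nonneg_orthant \<Longrightarrow> norm z \<le> K \<Longrightarrow> 1 \<le> r \<Longrightarrow> r < 1 + \<eta> \<Longrightarrow> \<bar>F (z /\<^sub>R r) - F z\<bar> \<le> e"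
proof -
  let ?S = "nonneg_orthant \<inter> cball 0 K :: (real ^ 'n) set"
  have "compact ?S" using closed_nonneg_orthant by (intro closed_Int_compact) auto
  moreover have "continuous_on ?S F" using test_funD(3)[OF F] by (rule continuous_on_subset) auto
  ultimately have "uniformly_continuous_on ?S F" by (rule compact_uniformly_continuous[rotated])
  then obtain d where d: "0 < d"
    "\<And>x x'. x \<in> ?S \<Longrightarrow> x' \<in> ?S \<Longrightarrow> dist x' x < d \<Longrightarrow> dist (F x') (F x) < e"
    using e unfolding uniformly_continuous_on_def by blast
  show ?thesis
  proof (rule that)
    \<comment> \<open>The denominator is positive for every real \<open>K\<close>.\<close>
    show "0 < d / (\<bar>K\<bar> + 1)" using d by simp
    fix z :: "real ^ 'n" and r :: real
    assume z: "z \<in> nonneg_orthant" "norm z \<le> K" and r: "1 \<le> r" "r < 1 + d / (\<bar>K\<bar> + 1)"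
    have "norm (z /\<^sub>R r) \<le> norm z"
      using r by (simp add: divide_inverse_commute[symmetric] divide_le_eq mult_le_cancel_left1)
    then have mem: "z /\<^sub>R r \<in> ?S" "z \<in> ?S" using z r by (auto intro: scaleR_nonneg_orthant)
    have "z - z /\<^sub>R r = (1 - 1 / r) *\<^sub>R z" by (simp add: algebra_simps inverse_eq_divide)
    then have "dist (z /\<^sub>R r) z = (1 - 1 / r) * norm z"
      using r by (simp add: dist_norm norm_minus_commute[of _ z])
    also have "\<dots> \<le> (r - 1) * K"
    proof (rule mult_mono)
      have "(r - 1) * 1 \<le> (r - 1) * r" using r by (intro mult_left_mono) auto
      then show "1 - 1 / r \<le> r - 1" using r by (simp add: field_simps)
    qed (use z r in auto)
    also have "\<dots> \<le> (r - 1) * (\<bar>K\<bar> + 1)" using r by (intro mult_left_mono) auto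
    also have "\<dots> < d" using r by (simp add: field_simps)
    finally show "\<bar>F (z /\<^sub>R r) - F z\<bar> \<le> e" using d(2)[OF mem(2) mem(1)] by (simp add: dist_real_def)
  qed
qed

section \<open>From the canonical scaling to normalisation by the tail\<close>

context mrv_vector
begin

lemma \<mu>_class: "\<mu> \<in> M_class i" and sets_\<mu>: "sets \<mu> = sets (subcone_borel i)"
  using mrv by (auto simp: MRV_def M_class_def)

lemma integrable_Z:
  assumes F: "test_fun i a M F" and r: "0 \<le> r"
  shows "integrable P (\<lambda>\<omega>. F (r *\<^sub>R Z \<omega>))"
proof (rule integrable_const_bound[where B = M])
  show "AE \<omega> in P. norm (F (r *\<^sub>R Z \<omega>)) \<le> M"
    using test_funD(4)[OF F] Z_nonneg r by (auto intro!: AE_I2 scaleR_nonneg_orthant)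
  show "(\<lambda>\<omega>. F (r *\<^sub>R Z \<omega>)) \<in> borel_measurable P"
    using Z_nonneg r by (intro test_fun_measurable[OF F]) (auto intro: scaleR_nonneg_orthant)
qed

lemma b_scaled_limit:
  assumes F: "test_fun i a M F"
  shows "((\<lambda>t. t * (\<integral>\<omega>. F (Z \<omega> /\<^sub>R b t) \<partial>P)) \<longlongrightarrow> integral\<^sup>L \<mu> F) at_top"
proof -
  have FM: "F \<in> M_test i" using M_test_of_test_fun[OF i F] .
  then have cont: "continuous_on (subcone i) F" by (simp add: M_test_def)
  have "((\<lambda>t. integral\<^sup>L (scale_measure (ennreal t)
      (restrict_space (distr P borel (\<lambda>\<omega>. Z \<omega> /\<^sub>R b t)) (subcone i))) F) \<longlongrightarrow> integral\<^sup>L \<mu> F) at_top"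
    using mrv FM by (auto simp: MRV_def M_converges_def)
  moreover have "\<forall>\<^sub>F t in at_top. integral\<^sup>L (scale_measure (ennreal t)
      (restrict_space (distr P borel (\<lambda>\<omega>. Z \<omega> /\<^sub>R b t)) (subcone i))) F
      = t * (\<integral>\<omega>. F (Z \<omega> /\<^sub>R b t) \<partial>P)"
    using b_pos eventually_gt_at_top[of 0]
  proof eventually_elim
    case (elim t)
    have "F (Z \<omega> /\<^sub>R b t) = 0" if "\<omega> \<in> space P" "Z \<omega> /\<^sub>R b t \<notin> subcone i" for \<omega>
    proof -
      have z: "Z \<omega> /\<^sub>R b t \<in> nonneg_orthant"
        using Z_nonneg that elim by (auto intro: scaleR_nonneg_orthant)
      with that show ?thesis
        using test_funD(1,6)[OF F] by (simp add: subcone_eq[OF i])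
    qed
    then show ?case
      using elim by (subst integral_scaled_restricted_law[OF i cont])
        (auto intro!: Bochner_Integration.integral_cong)
  qed
  ultimately show ?thesis by (rule Lim_transform_eventually)
qed

text \<open>Dominated convergence in \<open>N\<close>: at each fixed \<open>z\<close> the second
  factor is eventually 0. The cutoff is continuous rather than an indicator so that
  \<open>b_scaled_limit\<close> carries the smallness over to the laws of \<open>Z\<close>.\<close>

lemma tail_mass_small:
  assumes a: "0 < a" and e: "0 < e"
  obtains N where "integral\<^sup>L \<mu> (\<lambda>z. clamp01 (2 * ord_stat z i / a - 1) * clamp01 (norm z - real N)) < e"
proof -
  let ?\<theta> = "\<lambda>z :: real ^ 'd. clamp01 (2 * ord_stat z i / a - 1)"
  have \<theta>: "integrable \<mu> ?\<theta>"
    using test_fun_integrable[OF i \<mu>_class test_fun_cutoff[OF i a, of "\<lambda>_. 1"]] by simp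
  have tf: "test_fun i (a / 2) 1 (\<lambda>z. ?\<theta> z * clamp01 (norm z - real N))" for N
    by (intro test_fun_cutoff i a continuous_intros clamp01_simps)
  have "(\<lambda>N. integral\<^sup>L \<mu> (\<lambda>z. ?\<theta> z * clamp01 (norm z - real N))) \<longlonglongrightarrow> integral\<^sup>L \<mu> (\<lambda>_. 0)"
  proof (rule integral_dominated_convergence[OF _ _ \<theta>])
    show "(\<lambda>z. ?\<theta> z * clamp01 (norm z - real N)) \<in> borel_measurable \<mu>" for N
      using test_fun_integrable[OF i \<mu>_class tf] by simp
    show "AE z in \<mu>. norm (?\<theta> z * clamp01 (norm z - real N)) \<le> ?\<theta> z" for N
      using clamp01_simps by (intro AE_I2) (simp add: abs_mult mult_left_le)
    show "AE z in \<mu>. (\<lambda>N. ?\<theta> z * clamp01 (norm z - real N)) \<longlonglongrightarrow> 0"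
    proof (rule AE_I2, rule tendsto_eventually)
      fix z :: "real ^ 'd"
      obtain N0 :: nat where "norm z \<le> real N0" using real_arch_simple by blast
      then have "\<forall>N\<ge>N0. ?\<theta> z * clamp01 (norm z - real N) = 0" by (auto simp: clamp01_simps(3))
      then show "\<forall>\<^sub>F N in sequentially. ?\<theta> z * clamp01 (norm z - real N) = 0"
        unfolding eventually_sequentially by blast
    qed
  qed simp
  then have "\<forall>\<^sub>F N in sequentially. integral\<^sup>L \<mu> (\<lambda>z. ?\<theta> z * clamp01 (norm z - real N)) < e"
    using e by (intro order_tendstoD(2)) auto
  then show ?thesis using that by (auto simp: eventually_sequentially)
qed

text \<open>Since \<open>s = b t * (1 + o(1))\<close> for \<open>t = 1 / U s\<close>, only the effect of a dilation by a factor
  close to one has to be controlled; a test function is uniformly continuous on bounded sets, and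
  the mass far out in the cone is small.\<close>

lemma tail_scaled_limit:
  assumes F: "test_fun i a M F"
  shows "((\<lambda>s. (\<integral>\<omega>. F (Z \<omega> /\<^sub>R s) \<partial>P) / U s) \<longlongrightarrow> integral\<^sup>L \<mu> F) at_top"
proof -
  note FD = test_funD[OF F]
  let ?\<theta> = "\<lambda>z :: real ^ 'd. clamp01 (2 * ord_stat z i / a - 1)"
  let ?I = "\<lambda>G t. t * (\<integral>\<omega>. G (Z \<omega> /\<^sub>R b t) \<partial>P)"
  have \<theta>: "test_fun i (a / 2) 1 ?\<theta>"
    using test_fun_cutoff[OF i FD(1), of "\<lambda>_. 1"] by simp
  define L where "L = integral\<^sup>L \<mu> ?\<theta>"
  have L: "0 \<le> L" unfolding L_def by (intro integral_nonneg_AE AE_I2 clamp01_simps)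
  have diff: "((\<lambda>s. (\<integral>\<omega>. F (Z \<omega> /\<^sub>R s) \<partial>P) / U s - ?I F (1 / U s)) \<longlongrightarrow> 0) at_top"
  proof (rule tendstoI)
    fix e :: real assume e: "0 < e"
    \<comment> \<open>These make \<open>e1 * L < e / 2\<close> and
      \<open>2 * M * e2 \<le> e / 2\<close>; the added ones guard against \<open>L = 0\<close> and
      \<open>M = 0\<close>.\<close>
    define e1 where "e1 = e / (2 * (L + 1))"
    define e2 where "e2 = e / (4 * (M + 1))"
    have e1: "0 < e1" and e2: "0 < e2" using e L FD(2) by (auto simp: e1_def e2_def)
    obtain N where N: "integral\<^sup>L \<mu> (\<lambda>z. ?\<theta> z * clamp01 (norm z - real N)) < e2"
      using tail_mass_small[OF FD(1) e2] .
    let ?\<psi> = "\<lambda>z. ?\<theta> z * clamp01 (norm z - real N)"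
    have \<psi>: "test_fun i (a / 2) 1 ?\<psi>"
      by (intro test_fun_cutoff i FD(1) continuous_intros clamp01_simps)
    obtain \<eta> where \<eta>: "0 < \<eta>" "\<And>z r. z \<in> nonneg_orthant \<Longrightarrow> norm z \<le> real N + 1 \<Longrightarrow> 1 \<le> r \<Longrightarrow>
        r < 1 + \<eta> \<Longrightarrow> \<bar>F (z /\<^sub>R r) - F z\<bar> \<le> e1"
      using test_fun_dilation[OF F e1] by blast
    \<comment> \<open>Three regimes: below level \<open>a\<close> both values vanish, since
      shrinking lowers \<open>ord_stat\<close>; up to norm \<open>N + 1\<close> uniform continuity
      applies; beyond it the far cutoff is 1 and pays for the trivial bound
      \<open>2 * M\<close>.\<close>
    have ptw: "\<bar>F (z /\<^sub>R r) - F z\<bar> \<le> e1 * ?\<theta> z + 2 * M * ?\<psi> z"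
      if z: "z \<in> nonneg_orthant" and r: "1 \<le> r" "r < 1 + \<eta>" for z :: "real ^ 'd" and r
    proof -
      have zr: "z /\<^sub>R r \<in> nonneg_orthant" using z r by (auto intro: scaleR_nonneg_orthant)
      have nn: "0 \<le> e1 * ?\<theta> z" "0 \<le> 2 * M * ?\<psi> z"
        using e1 FD(2) clamp01_simps(1) by (auto intro!: mult_nonneg_nonneg)
      consider "ord_stat z i < a" | "a \<le> ord_stat z i" "norm z \<le> real N + 1"
        | "a \<le> ord_stat z i" "real N + 1 < norm z" by linarith
      then show ?thesis
      proof cases
        case 1
        have "ord_stat (z /\<^sub>R r) i = ord_stat z i / r"
          using ord_stat_scale[OF i, of "inverse r" z] r by (simp add: divide_inverse_commute)
        also have "\<dots> \<le> ord_stat z i"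
          using r ord_stat_nonneg[OF i z] by (simp add: divide_le_eq mult_le_cancel_left1)
        finally have "F (z /\<^sub>R r) = 0" "F z = 0" using 1 FD(6) z zr by auto
        with nn show ?thesis by simp
      next
        case 2
        then have "?\<theta> z = 1" using FD(1) by (intro clamp01_simps) (simp add: field_simps)
        with \<eta>(2)[OF z 2(2) r] nn show ?thesis by simp
      next
        case 3
        then have "?\<theta> z = 1" "clamp01 (norm z - real N) = 1"
          using FD(1) by (auto intro!: clamp01_simps simp: field_simps)
        moreover have "\<bar>F (z /\<^sub>R r) - F z\<bar> \<le> 2 * M" using FD(4)[OF z] FD(4)[OF zr] by linarith
        ultimately show ?thesis using nn by simp
      qed
    qed
    \<comment> \<open>The majorant is a combination of test functions, so its scaled expectation
      converges along \<open>b\<close>.\<close>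
    have lim: "((\<lambda>t. e1 * ?I ?\<theta> t + 2 * M * ?I ?\<psi> t) \<longlongrightarrow> e1 * L + 2 * M * integral\<^sup>L \<mu> ?\<psi>) at_top"
      unfolding L_def by (intro tendsto_intros b_scaled_limit[OF \<theta>] b_scaled_limit[OF \<psi>])
    have "e1 * L < e / 2" unfolding e1_def using e L by (simp add: field_simps)
    moreover have "2 * M * integral\<^sup>L \<mu> ?\<psi> \<le> 2 * M * e2"
      using N FD(2) by (intro mult_left_mono) auto
    moreover have "2 * M * e2 \<le> e / 2" unfolding e2_def using e FD(2) by (simp add: field_simps)
    ultimately have "e1 * L + 2 * M * integral\<^sup>L \<mu> ?\<psi> < e" by linarith
    from eventually_compose_filterlim[OF order_tendstoD(2)[OF lim this] inverse_U_at_top]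
    have small: "\<forall>\<^sub>F s in at_top. e1 * ?I ?\<theta> (1 / U s) + 2 * M * ?I ?\<psi> (1 / U s) < e" .
    have ratio: "\<forall>\<^sub>F s in at_top. s / b (1 / U s) < 1 + \<eta>"
      using \<eta>(1) by (intro order_tendstoD(2)[OF div_b_tendsto_1]) simp
    have big: "\<forall>\<^sub>F s in at_top. 1 < 1 / U s"
      using filterlim_at_top_dense[THEN iffD1, OF inverse_U_at_top] by blast
    show "\<forall>\<^sub>F s in at_top. dist ((\<integral>\<omega>. F (Z \<omega> /\<^sub>R s) \<partial>P) / U s - ?I F (1 / U s)) 0 < e"
      using small ratio big eventually_compose_filterlim[OF b_pos inverse_U_at_top]
        eventually_gt_at_top[of 0]
    proof eventually_elim
      case (elim s)
      define t where "t = 1 / U s"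
      define r where "r = s / b t"
      have bt: "0 < b t" and t: "1 < t" using elim by (auto simp: t_def)
      \<comment> \<open>\<open>U s\<close> equals \<open>1 / t\<close> by the choice of
        \<open>t\<close>, so \<open>s\<close> is never below \<open>b t\<close> and the dilation
        factor \<open>r\<close> is at least 1.\<close>
      have "b t \<le> s" using t by (intro b_le) (auto simp: t_def)
      then have r: "1 \<le> r" "r < 1 + \<eta>" using bt elim by (auto simp: r_def t_def)
      have Zs: "Z \<omega> /\<^sub>R s = (Z \<omega> /\<^sub>R b t) /\<^sub>R r" for \<omega>
        using bt elim by (simp add: r_def field_simps)
      have int: "integrable P (\<lambda>\<omega>. G (Z \<omega> /\<^sub>R c))" if "test_fun i a' M' G" "0 < c" for G a' M' c
        using integrable_Z[OF that(1), of "inverse c"] that(2) by simp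
      have "\<bar>(\<integral>\<omega>. F (Z \<omega> /\<^sub>R s) \<partial>P) - (\<integral>\<omega>. F (Z \<omega> /\<^sub>R b t) \<partial>P)\<bar>
          = \<bar>\<integral>\<omega>. F (Z \<omega> /\<^sub>R s) - F (Z \<omega> /\<^sub>R b t) \<partial>P\<bar>"
        using int[OF F] bt elim by (subst Bochner_Integration.integral_diff) auto
      also have "\<dots> \<le> (\<integral>\<omega>. \<bar>F (Z \<omega> /\<^sub>R s) - F (Z \<omega> /\<^sub>R b t)\<bar> \<partial>P)"
        by (rule integral_abs_bound)
      also have "\<dots> \<le> (\<integral>\<omega>. e1 * ?\<theta> (Z \<omega> /\<^sub>R b t) + 2 * M * ?\<psi> (Z \<omega> /\<^sub>R b t) \<partial>P)"
      proof (rule integral_mono)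
        show "integrable P (\<lambda>\<omega>. \<bar>F (Z \<omega> /\<^sub>R s) - F (Z \<omega> /\<^sub>R b t)\<bar>)"
          using int[OF F] bt elim by (intro integrable_abs Bochner_Integration.integrable_diff) auto
        show "integrable P (\<lambda>\<omega>. e1 * ?\<theta> (Z \<omega> /\<^sub>R b t) + 2 * M * ?\<psi> (Z \<omega> /\<^sub>R b t))"
          using int[OF \<theta>] int[OF \<psi>] bt
          by (intro Bochner_Integration.integrable_add integrable_mult_right) auto
        show "\<bar>F (Z \<omega> /\<^sub>R s) - F (Z \<omega> /\<^sub>R b t)\<bar>
            \<le> e1 * ?\<theta> (Z \<omega> /\<^sub>R b t) + 2 * M * ?\<psi> (Z \<omega> /\<^sub>R b t)" if "\<omega> \<in> space P" for \<omega>
          unfolding Zs using Z_nonneg[OF that] bt r by (intro ptw) (auto intro: scaleR_nonneg_orthant)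
      qed
      also have "\<dots> = e1 * (\<integral>\<omega>. ?\<theta> (Z \<omega> /\<^sub>R b t) \<partial>P) + 2 * M * (\<integral>\<omega>. ?\<psi> (Z \<omega> /\<^sub>R b t) \<partial>P)"
        using int[OF \<theta> bt] int[OF \<psi> bt] by (subst Bochner_Integration.integral_add) auto
      finally have "t * \<bar>(\<integral>\<omega>. F (Z \<omega> /\<^sub>R s) \<partial>P) - (\<integral>\<omega>. F (Z \<omega> /\<^sub>R b t) \<partial>P)\<bar>
          \<le> t * (e1 * (\<integral>\<omega>. ?\<theta> (Z \<omega> /\<^sub>R b t) \<partial>P) + 2 * M * (\<integral>\<omega>. ?\<psi> (Z \<omega> /\<^sub>R b t) \<partial>P))"
        using t by (intro mult_left_mono) auto
      also have "\<dots> = e1 * ?I ?\<theta> t + 2 * M * ?I ?\<psi> t" by (simp add: algebra_simps)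
      also have "\<dots> < e" using elim by (simp add: t_def)
      finally have "\<bar>t * ((\<integral>\<omega>. F (Z \<omega> /\<^sub>R s) \<partial>P) - (\<integral>\<omega>. F (Z \<omega> /\<^sub>R b t) \<partial>P))\<bar> < e"
        using t by (simp add: abs_mult)
      then show ?case by (simp add: t_def algebra_simps)
    qed
  qed
  from tendsto_add[OF this filterlim_compose[OF b_scaled_limit[OF F] inverse_U_at_top]]
  show ?thesis by simp
qed

text \<open>Potter's bound passed to the limit through a cutoff that is 1 on the superlevel set. The
  cutoff vanishes up to \<open>1 / (2 * x)\<close>, so the smaller level \<open>1 / (3 * x)\<close>
  captures its support.\<close>

lemma potter_\<mu>:
  assumes potter: "\<And>t x. t0 \<le> t \<Longrightarrow> 1 \<le> x \<Longrightarrow> U (t / x) \<le> C * x powr p * U t" and x: "1 \<le> x"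
  shows "emeasure \<mu> {z \<in> subcone i. 1 / x \<le> ord_stat z i} \<le> ennreal (C * (3 * x) powr p)"
proof -
  let ?\<theta> = "\<lambda>z :: real ^ 'd. clamp01 (2 * ord_stat z i / (1 / x) - 1)"
  let ?S = "{z \<in> subcone i. 1 / x \<le> ord_stat z i} :: (real ^ 'd) set"
  have x0: "0 < 1 / x" using x by simp
  have \<theta>: "test_fun i (1 / x / 2) 1 ?\<theta>"
    using test_fun_cutoff[OF i x0, of "\<lambda>_. 1"] by simp
  have le: "integral\<^sup>L \<mu> ?\<theta> \<le> C * (3 * x) powr p"
  proof (rule tendsto_upperbound[OF tail_scaled_limit[OF \<theta>]])
    show "\<forall>\<^sub>F s in at_top. (\<integral>\<omega>. ?\<theta> (Z \<omega> /\<^sub>R s) \<partial>P) / U s \<le> C * (3 * x) powr p"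
      using eventually_ge_at_top[of t0] eventually_gt_at_top[of 0]
    proof eventually_elim
      case (elim s)
      have "(\<integral>\<omega>. ?\<theta> (Z \<omega> /\<^sub>R s) \<partial>P)
          \<le> (\<integral>\<omega>. indicator {\<omega> \<in> space P. s / (3 * x) < ord_stat (Z \<omega>) i} \<omega> \<partial>P)"
      proof (rule integral_mono)
        show "integrable P (\<lambda>\<omega>. ?\<theta> (Z \<omega> /\<^sub>R s))"
          using integrable_Z[OF \<theta>, of "inverse s"] elim by simp
        show "?\<theta> (Z \<omega> /\<^sub>R s) \<le> indicator {\<omega> \<in> space P. s / (3 * x) < ord_stat (Z \<omega>) i} \<omega>"
          if \<omega>: "\<omega> \<in> space P" for \<omega>
        proof (cases "s / (3 * x) < ord_stat (Z \<omega>) i")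
          case True
          with \<omega> clamp01_simps show ?thesis by simp
        next
          case False
          have "x * (ord_stat (Z \<omega>) i / s) \<le> 1 / 3" using False x elim by (simp add: field_simps)
          moreover have "ord_stat (Z \<omega> /\<^sub>R s) i = ord_stat (Z \<omega>) i / s"
            using ord_stat_scale[OF i, of "inverse s" "Z \<omega>"] elim by (simp add: divide_inverse_commute)
          ultimately have "?\<theta> (Z \<omega> /\<^sub>R s) = 0"
            by (intro clamp01_simps) (simp add: mult.commute)
          then show ?thesis by simp
        qed
      qed (auto intro!: integrable_real_indicator simp: emeasure_eq_measure)
      also have "\<dots> = U (s / (3 * x))" by (simp add: U_def)
      also have "\<dots> \<le> C * (3 * x) powr p * U s" using elim x by (intro potter) auto
      finally show ?case using U_pos[of s] by (simp add: pos_divide_le_eq)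
    qed
  qed simp
  have "emeasure \<mu> ?S = (\<integral>\<^sup>+z. indicator ?S z \<partial>\<mu>)"
    using sets_ord_stat_ge[OF i sets_\<mu>] by simp
  also have "\<dots> \<le> (\<integral>\<^sup>+z. ennreal (?\<theta> z) \<partial>\<mu>)"
  proof (rule nn_integral_mono)
    fix z :: "real ^ 'd"
    show "indicator ?S z \<le> ennreal (?\<theta> z)"
    proof (cases "z \<in> ?S")
      case True
      then have "?\<theta> z = 1" using x by (intro clamp01_simps) (simp add: field_simps)
      then show ?thesis by (simp add: indicator_def)
    qed simp
  qed
  also have "\<dots> = ennreal (integral\<^sup>L \<mu> ?\<theta>)"
    by (intro nn_integral_eq_integral test_fun_integrable[OF i \<mu>_class \<theta>] AE_I2 clamp01_simps)
  also have "\<dots> \<le> ennreal (C * (3 * x) powr p)" by (rule ennreal_leI[OF le])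
  finally show ?thesis .
qed

end

section \<open>Random matrices\<close>

lemma component_le_ord_stat_1: "v $ l \<le> ord_stat (v :: real ^ 'n::finite) 1"
proof -
  have "card {l} \<le> card {m. v $ l \<le> v $ m}" by (intro card_mono) auto
  moreover have "1 \<in> {1..CARD('n)}" by (simp add: Suc_leI)
  ultimately show ?thesis by (subst le_ord_stat_iff) auto
qed

lemma ord_stat_mult_le_sum:
  fixes B :: "real ^ 'd::finite ^ 'q::finite"
  assumes k: "k \<in> {1..CARD('q)}" and B: "\<And>r c. 0 \<le> B $ r $ c" and z: "z \<in> nonneg_orthant"
  shows "ord_stat (B *v z) k \<le> (\<Sum>r\<in>UNIV. \<Sum>c\<in>UNIV. B $ r $ c) * ord_stat z 1"
proof -
  have z1: "0 \<le> ord_stat z 1" using z by (intro ord_stat_nonneg) (auto simp: Suc_leI)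
  have "(B *v z) $ r \<le> (\<Sum>r\<in>UNIV. \<Sum>c\<in>UNIV. B $ r $ c) * ord_stat z 1" for r
  proof -
    have "(B *v z) $ r \<le> (\<Sum>c\<in>UNIV. B $ r $ c * ord_stat z 1)"
      unfolding matrix_vector_mult_def using B component_le_ord_stat_1[of z]
      by (auto intro!: sum_mono mult_left_mono)
    also have "\<dots> = (\<Sum>c\<in>UNIV. B $ r $ c) * ord_stat z 1" by (simp add: sum_distrib_right)
    also have "\<dots> \<le> (\<Sum>r\<in>UNIV. \<Sum>c\<in>UNIV. B $ r $ c) * ord_stat z 1"
      using B z1 by (intro mult_right_mono member_le_sum) (auto intro!: sum_nonneg)
    finally show ?thesis .
  qed
  with ord_stat_le_add[OF k, of "B *v z" 0] ord_stat_zero[OF k] show ?thesis by simp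
qed

text \<open>\<open>Max\<close> says nothing about an empty set, so a member is exhibited: index 1
  always qualifies, because every component of \<open>B *v z\<close> is at most the sum of all
  entries of \<open>B\<close> times the largest component of \<open>z\<close>.\<close>

lemma \<tau>_mat_index_of_finite:
  fixes B :: "real ^ 'd::finite ^ 'q::finite"
  assumes k: "k \<in> {1..CARD('q)}" and B: "\<And>r c. 0 \<le> B $ r $ c" and i: "index_of k B = i"
  shows "\<tau>_mat k i B < \<infinity>"
proof -
  let ?J = "{j \<in> {1..CARD('d)}. \<tau>_mat k j B < \<infinity>}"
  have 1: "1 \<in> {1..CARD('d)}" by (simp add: Suc_leI)
  have "\<tau>_mat k 1 B \<le> ennreal (\<Sum>r\<in>UNIV. \<Sum>c\<in>UNIV. B $ r $ c)"
    unfolding \<tau>_mat_def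
  proof (intro SUP_least ennreal_leI)
    fix z :: "real ^ 'd" assume "z \<in> subcone 1"
    then have "z \<in> nonneg_orthant" "0 < ord_stat z 1" unfolding subcone_eq[OF 1] by auto
    then show "ord_stat (B *v z) k / ord_stat z 1 \<le> (\<Sum>r\<in>UNIV. \<Sum>c\<in>UNIV. B $ r $ c)"
      using ord_stat_mult_le_sum[OF k B] by (simp add: pos_divide_le_eq)
  qed
  then have "\<tau>_mat k 1 B < \<infinity>" using le_less_trans[OF _ ennreal_less_top] by auto
  with 1 have "1 \<in> ?J" by blast
  then have "?J \<noteq> {}" by blast
  moreover have "finite ?J" by simp
  ultimately have "Max ?J \<in> ?J" by (intro Max_in)
  with i show ?thesis by (auto simp: index_of_def)
qed

text \<open>On the boundary of the subcone the bound follows by approximating \<open>z\<close> with \<open>z + (e, ..., e)\<close>.\<close>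

lemma ord_stat_mult_le_\<tau>_mat:
  fixes B :: "real ^ 'd::finite ^ 'q::finite"
  assumes i: "i \<in> {1..CARD('d)}" and k: "k \<in> {1..CARD('q)}" and B: "\<And>r c. 0 \<le> B $ r $ c"
    and fin: "\<tau>_mat k i B < \<infinity>" and z: "z \<in> nonneg_orthant"
  shows "ord_stat (B *v z) k \<le> enn2real (\<tau>_mat k i B) * ord_stat z i"
proof -
  define \<tau> where "\<tau> = enn2real (\<tau>_mat k i B)"
  have \<tau>: "\<tau>_mat k i B = ennreal \<tau>" "0 \<le> \<tau>" using fin by (auto simp: \<tau>_def)
  have step: "ord_stat (B *v z) k \<le> \<tau> * (ord_stat z i + e)" if e: "0 < e" for e
  proof -
    define w :: "real ^ 'd" where "w = (\<chi> l. z $ l + e)"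
    have w: "w \<in> nonneg_orthant" using z e by (auto simp: w_def nonneg_orthant_def intro: add_nonneg_nonneg)
    have "{l. e \<le> w $ l} = UNIV" using z by (auto simp: w_def nonneg_orthant_def)
    then have "e \<le> ord_stat w i" using i by (subst le_ord_stat_iff) auto
    then have pos: "0 < ord_stat w i" using e by simp
    have "w \<in> subcone i" using w pos by (simp add: subcone_eq[OF i])
    then have "ennreal (ord_stat (B *v w) k / ord_stat w i) \<le> ennreal \<tau>"
      unfolding \<tau>(1)[symmetric] \<tau>_mat_def by (rule SUP_upper)
    then have "ord_stat (B *v w) k / ord_stat w i \<le> \<tau>" using \<tau>(2) by (simp add: ennreal_le_iff)
    then have "ord_stat (B *v w) k \<le> \<tau> * ord_stat w i" using pos by (simp add: pos_divide_le_eq)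
    moreover have "(B *v z) $ r \<le> (B *v w) $ r + 0" for r
      unfolding matrix_vector_mult_def using B e by (auto simp: w_def intro!: sum_mono mult_left_mono)
    then have "ord_stat (B *v z) k \<le> ord_stat (B *v w) k + 0" by (rule ord_stat_le_add[OF k])
    moreover have "ord_stat w i \<le> ord_stat z i + e"
      by (rule ord_stat_le_add[OF i]) (simp add: w_def)
    then have "\<tau> * ord_stat w i \<le> \<tau> * (ord_stat z i + e)" using \<tau>(2) by (rule mult_left_mono)
    ultimately show ?thesis by simp
  qed
  have "ord_stat (B *v z) k \<le> \<tau> * ord_stat z i + e" if e: "0 < e" for e
  proof -
    \<comment> \<open>Perturbing by \<open>e / (\<tau> + 1)\<close> keeps the error below
      \<open>e\<close> even if \<tau> is large, and is well defined if it is 0.\<close>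
    have "ord_stat (B *v z) k \<le> \<tau> * (ord_stat z i + e / (\<tau> + 1))"
      using \<tau>(2) e by (intro step) auto
    also have "\<dots> = \<tau> * ord_stat z i + (\<tau> / (\<tau> + 1)) * e" by (simp add: algebra_simps)
    also have "\<dots> \<le> \<tau> * ord_stat z i + 1 * e"
      using \<tau>(2) e by (intro add_left_mono mult_right_mono) auto
    finally show ?thesis by simp
  qed
  then show ?thesis unfolding \<tau>_def[symmetric] by (rule field_le_epsilon)
qed

lemma continuous_on_matrix_vector_mult [continuous_intros]:
  fixes f :: "_ \<Rightarrow> real ^ 'd::finite ^ 'q::finite"
  assumes "continuous_on S f" "continuous_on S g"
  shows "continuous_on S (\<lambda>x. f x *v g x)"
  unfolding matrix_vector_mult_def using assms by (intro continuous_intros)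

lemma measurable_matrix_vector_mult:
  fixes f :: "_ \<Rightarrow> real ^ 'd::finite ^ 'q::finite"
  assumes "f \<in> borel_measurable N" "g \<in> borel_measurable N"
  shows "(\<lambda>x. f x *v g x) \<in> borel_measurable N"
  using assms by (rule borel_measurable_continuous_Pair) (intro continuous_intros)

text \<open>The supremum is over an uncountable family, but each quotient is continuous in
  \<open>B\<close>, so the supremum is lower semicontinuous and its strict superlevel sets are
  open.\<close>

lemma measurable_\<tau>_mat:
  assumes k: "k \<in> {1..CARD('q)}"
  shows "(\<tau>_mat k i :: real ^ 'd::finite ^ 'q::finite \<Rightarrow> ennreal) \<in> borel_measurable borel"
proof (rule borel_measurableI_greater)
  fix y :: ennreal
  have "{B :: real ^ 'd ^ 'q. y < \<tau>_mat k i B}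
      = (\<Union>z\<in>subcone i. {B. y < ennreal (ord_stat (B *v z) k / ord_stat z i)})"
    by (auto simp: \<tau>_mat_def less_SUP_iff)
  also have "open \<dots>"
  proof (intro open_UN ballI open_Collect_less continuous_on_const continuous_on_ennreal)
    fix z :: "real ^ 'd"
    have "continuous_on UNIV (\<lambda>B :: real ^ 'd ^ 'q. ord_stat (B *v z) k)"
      by (rule continuous_on_compose2[OF continuous_on_ord_stat[OF k, of UNIV]])
        (auto intro!: continuous_intros)
    then show "continuous_on UNIV (\<lambda>B :: real ^ 'd ^ 'q. ord_stat (B *v z) k / ord_stat z i)"
      unfolding divide_inverse by (intro continuous_intros)
  qed
  finally show "{B \<in> space borel. y < (\<tau>_mat k i :: real ^ 'd ^ 'q \<Rightarrow> ennreal) B} \<in> sets borel" by simp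
qed

lemma measurable_index_of:
  assumes k: "k \<in> {1..CARD('q)}"
  shows "(index_of k :: real ^ 'd::finite ^ 'q::finite \<Rightarrow> nat) \<in> measurable borel (count_space UNIV)"
proof -
  note measurable_\<tau>_mat[OF k, measurable]
  show ?thesis unfolding index_of_def by measurable
qed

text \<open>Independence is expressed by two copies of the probability space, so that Fubini freezes
  \<open>X \<omega>\<close> and leaves an inner expectation over \<open>Y\<close>.\<close>

lemma distr_indep_rv:
  fixes X :: "'w \<Rightarrow> 'a::second_countable_topology" and Y :: "'w \<Rightarrow> 'b::second_countable_topology"
  assumes "prob_space P" and X: "X \<in> borel_measurable P" and Y: "Y \<in> borel_measurable P"
    and indep: "indep_rv P X Y"
  shows "distr P (borel \<Otimes>\<^sub>M borel) (\<lambda>\<omega>. (X \<omega>, Y \<omega>))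
    = distr (P \<Otimes>\<^sub>M P) (borel \<Otimes>\<^sub>M borel) (\<lambda>(\<omega>, \<omega>'). (X \<omega>, Y \<omega>'))"
proof -
  interpret prob_space P by fact
  note [measurable] = X Y
  interpret DX: prob_space "distr P borel X" by (rule prob_space_distr) measurable
  interpret DY: prob_space "distr P borel Y" by (rule prob_space_distr) measurable
  have "distr P borel X \<Otimes>\<^sub>M distr P borel Y = distr P (borel \<Otimes>\<^sub>M borel) (\<lambda>\<omega>. (X \<omega>, Y \<omega>))"
  proof (rule pair_measure_eqI)
    fix S T assume "S \<in> sets (distr P borel X)" "T \<in> sets (distr P borel Y)"
    then have [measurable]: "S \<in> sets borel" "T \<in> sets borel" by auto
    have "prob ((X -` S \<inter> space P) \<inter> (Y -` T \<inter> space P))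
        = prob (X -` S \<inter> space P) * prob (Y -` T \<inter> space P)"
      using indep unfolding indep_rv_def
      by (rule indep_setD) (auto simp: sets_vimage_algebra2)
    moreover have "(X -` S \<inter> space P) \<inter> (Y -` T \<inter> space P)
        = (\<lambda>\<omega>. (X \<omega>, Y \<omega>)) -` (S \<times> T) \<inter> space P" by auto
    ultimately show "emeasure (distr P borel X) S * emeasure (distr P borel Y) T
        = emeasure (distr P (borel \<Otimes>\<^sub>M borel) (\<lambda>\<omega>. (X \<omega>, Y \<omega>))) (S \<times> T)"
      by (simp add: emeasure_distr emeasure_eq_measure ennreal_mult)
  qed (simp_all add: DX.sigma_finite_measure_axioms DY.sigma_finite_measure_axioms
      cong: sets_pair_measure_cong)
  then show ?thesis
    by (subst (asm) pair_measure_distr[OF X Y DY.sigma_finite_measure_axioms]) simp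
qed

section \<open>The product of a random matrix and a regularly varying vector\<close>

locale mrv_random_matrix = mrv_vector P Z \<alpha> \<mu> i
  for P :: "'w measure" and Z :: "'w \<Rightarrow> real ^ 'd::finite" and \<alpha> \<mu> i +
  fixes A :: "'w \<Rightarrow> real ^ 'd ^ 'q::finite" and k :: nat and p :: real
  assumes k: "k \<in> {1..CARD('q)}"
    and A_measurable [measurable]: "A \<in> borel_measurable P"
    and A_nonneg: "\<And>\<omega> r c. \<omega> \<in> space P \<Longrightarrow> 0 \<le> A \<omega> $ r $ c"
    and indep: "indep_rv P A Z"
    and p: "\<alpha> < p"
    and moment: "(\<integral>\<^sup>+\<omega>\<in>\<Omega>_part P A k i. ennreal (enn2real (\<tau>_mat k i (A \<omega>)) powr p) \<partial>P) < \<infinity>"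
begin

text \<open>\<open>enn2real\<close> sends infinity to 0, so this value is meaningful only where the
  supremum is finite, in particular on \<open>\<Omega>\<close>, to which the estimates below are
  confined.\<close>

definition \<tau> :: "'w \<Rightarrow> real" where "\<tau> \<omega> = enn2real (\<tau>_mat k i (A \<omega>))"

abbreviation "\<Omega> \<equiv> \<Omega>_part P A k i"

lemma \<tau>_measurable [measurable]: "\<tau> \<in> borel_measurable P"
  unfolding \<tau>_def using measurable_compose[OF A_measurable measurable_\<tau>_mat[OF k, of i]] by measurable

lemma \<tau>_nonneg: "0 \<le> \<tau> \<omega>"
  by (simp add: \<tau>_def)

lemma \<Omega>_sets [measurable]: "\<Omega> \<in> sets P"
proof -
  have [measurable]: "(\<lambda>\<omega>. index_of k (A \<omega>)) \<in> measurable P (count_space UNIV)"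
    using measurable_compose[OF A_measurable measurable_index_of[OF k]] .
  show ?thesis unfolding \<Omega>_part_def by measurable
qed

lemma \<Omega>_subset: "\<omega> \<in> \<Omega> \<Longrightarrow> \<omega> \<in> space P"
  by (simp add: \<Omega>_part_def)

lemma ord_stat_A_le:
  assumes "\<omega> \<in> \<Omega>" "z \<in> nonneg_orthant"
  shows "ord_stat (A \<omega> *v z) k \<le> \<tau> \<omega> * ord_stat z i"
  unfolding \<tau>_def using assms A_nonneg[of \<omega>] \<tau>_mat_index_of_finite[OF k, of "A \<omega>" i]
  by (intro ord_stat_mult_le_\<tau>_mat i k) (auto simp: \<Omega>_part_def)

lemma A_orthant: "\<omega> \<in> space P \<Longrightarrow> z \<in> nonneg_orthant \<Longrightarrow> A \<omega> *v z \<in> nonneg_orthant"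
  using A_nonneg by (intro matrix_vector_nonneg_orthant)

text \<open>This is the integrable majorant. The summand 1 keeps the base at least 1, as Potter's
  bound requires, and the factor 2 supplies the strict inequality in \<open>U\<close>. Splitting at
  \<open>2 * \<tau> / c = 1\<close> bounds the power by a multiple of \<open>\<tau> powr p\<close>
  plus a constant.\<close>

lemma integrable_moment:
  assumes c: "0 < c"
  shows "integrable P (\<lambda>\<omega>. indicator \<Omega> \<omega> * (2 * \<tau> \<omega> / c + 1) powr p)"
proof -
  have p0: "0 < p" using p \<alpha>_pos by simp
  have "integrable P (\<lambda>\<omega>. indicator \<Omega> \<omega> * \<tau> \<omega> powr p)"
  proof (rule integrableI_nonneg)
    have "(\<integral>\<^sup>+\<omega>. ennreal (indicator \<Omega> \<omega> * \<tau> \<omega> powr p) \<partial>P)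
      = (\<integral>\<^sup>+\<omega>\<in>\<Omega>. ennreal (enn2real (\<tau>_mat k i (A \<omega>)) powr p) \<partial>P)"
      by (intro nn_integral_cong) (auto simp: \<tau>_def indicator_def)
    with moment show "(\<integral>\<^sup>+\<omega>. ennreal (indicator \<Omega> \<omega> * \<tau> \<omega> powr p) \<partial>P) < \<infinity>" by simp
  qed auto
  then have "integrable P (\<lambda>\<omega>. (4 / c) powr p * (indicator \<Omega> \<omega> * \<tau> \<omega> powr p) + 2 powr p)"
    by simp
  then show ?thesis
  proof (rule Bochner_Integration.integrable_bound)
    have "(2 * t / c + 1) powr p \<le> (4 / c) powr p * t powr p + 2 powr p" if t: "0 \<le> t" for t
    proof (cases "2 * t / c \<le> 1")
      case True
      then have "(2 * t / c + 1) powr p \<le> 2 powr p" using t c p0 by (intro powr_mono2) auto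
      then show ?thesis by (simp add: add_increasing)
    next
      case False
      then have "(2 * t / c + 1) powr p \<le> (4 / c * t) powr p"
        using t c p0 by (intro powr_mono2) (auto simp: field_simps)
      also have "\<dots> = (4 / c) powr p * t powr p" by (rule powr_mult)
      finally show ?thesis by (simp add: add_increasing2)
    qed
    from this[OF \<tau>_nonneg]
    show "AE \<omega> in P. norm (indicator \<Omega> \<omega> * (2 * \<tau> \<omega> / c + 1) powr p)
        \<le> norm ((4 / c) powr p * (indicator \<Omega> \<omega> * \<tau> \<omega> powr p) + 2 powr p)"
      by (intro AE_I2) (auto simp: indicator_def)
  qed measurable
qed

text \<open>An image of a product measure is a measure by construction; once its values are
  identified with \<open>limit_fun\<close> by Fubini, both claims about the limit set function
  follow.\<close>

definition \<nu> :: "(real ^ 'q) measure" where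
  "\<nu> = restrict_space (distr (P_part P A k i \<Otimes>\<^sub>M \<mu>) borel (\<lambda>(\<omega>, z). A \<omega> *v z)) (subcone k)"

lemma finite_P_part: "finite_measure (P_part P A k i)"
  unfolding P_part_def by (rule finite_measureI) (simp add: emeasure_restricted emeasure_eq_measure)

lemma sets_P_part [measurable_cong]: "sets (P_part P A k i) = sets P"
  and space_P_part: "space (P_part P A k i) = space P"
  by (simp_all add: P_part_def)

lemma space_\<mu>: "space \<mu> = subcone i"
  using space_subcone_borel[OF i sets_\<mu>] .

lemma \<mu>_ident [measurable]: "(\<lambda>z. z) \<in> borel_measurable \<mu>"
  by (rule measurable_subcone_ident[OF i sets_\<mu>])

lemma snd_\<mu> [measurable]: "snd \<in> borel_measurable (N \<Otimes>\<^sub>M \<mu>)"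
  using measurable_compose[OF measurable_snd \<mu>_ident] by simp

lemma A_mult_measurable [measurable]:
  "(\<lambda>(\<omega>, z). A \<omega> *v z) \<in> borel_measurable (P_part P A k i \<Otimes>\<^sub>M \<mu>)"
  "(\<lambda>(\<omega>, z). A \<omega> *v z) \<in> borel_measurable (P \<Otimes>\<^sub>M \<mu>)"
  "(\<lambda>(\<omega>, z). A \<omega> *v Z z) \<in> borel_measurable (P \<Otimes>\<^sub>M P)"
  unfolding case_prod_beta by (intro measurable_matrix_vector_mult; measurable)+

lemma sets_\<nu>: "sets \<nu> = sets (subcone_borel k)"
  by (simp add: \<nu>_def subcone_borel_def sets_restrict_space)

lemma emeasure_\<nu>:
  assumes S: "S \<in> sets \<nu>"
  shows "emeasure \<nu> S = limit_fun P A \<mu> k i S"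
proof -
  interpret \<mu>: sigma_finite_measure \<mu> by (rule sigma_finite_M_class[OF i \<mu>_class])
  have sub: "S \<subseteq> subcone k" using sets.sets_into_space[OF S] space_subcone_borel[OF k sets_\<nu>] by simp
  note sets_subcone[OF k, measurable]
  have [measurable]: "S \<in> sets borel"
    using S sets_subcone[OF k] by (simp add: sets_\<nu> subcone_borel_def sets_restrict_space_iff)
  let ?T = "(\<lambda>(\<omega>, z). A \<omega> *v z) -` S \<inter> space (P_part P A k i \<Otimes>\<^sub>M \<mu>)"
  let ?T' = "(\<lambda>(\<omega>, z). A \<omega> *v z) -` S \<inter> space (P \<Otimes>\<^sub>M \<mu>)"
  have T: "?T \<in> sets (P_part P A k i \<Otimes>\<^sub>M \<mu>)" and T': "?T' \<in> sets (P \<Otimes>\<^sub>M \<mu>)" by measurable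
  have TT: "?T = ?T'" by (simp add: space_pair_measure space_P_part)
  have "emeasure \<nu> S = emeasure (P_part P A k i \<Otimes>\<^sub>M \<mu>) ?T"
    unfolding \<nu>_def using sub by (subst emeasure_restrict_space) (auto simp: emeasure_distr)
  also have "\<dots> = (\<integral>\<^sup>+\<omega>. emeasure \<mu> (Pair \<omega> -` ?T) \<partial>P_part P A k i)"
    by (rule \<mu>.emeasure_pair_measure_alt[OF T])
  also have "\<dots> = (\<integral>\<^sup>+\<omega>. indicator \<Omega> \<omega> * emeasure \<mu> (Pair \<omega> -` ?T') \<partial>P)"
    unfolding TT unfolding P_part_def
    using \<mu>.measurable_emeasure_Pair[OF T'] by (subst nn_integral_density) auto
  also have "\<dots> = limit_fun P A \<mu> k i S"
    unfolding limit_fun_def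
  proof (rule nn_integral_cong)
    fix \<omega> assume "\<omega> \<in> space P"
    then have "Pair \<omega> -` ?T' = {z \<in> subcone i. A \<omega> *v z \<in> S}"
      by (auto simp: space_pair_measure space_\<mu>)
    then show "indicator \<Omega> \<omega> * emeasure \<mu> (Pair \<omega> -` ?T')
        = emeasure \<mu> {z \<in> subcone i. A \<omega> *v z \<in> S} * indicator \<Omega> \<omega>"
      by (simp add: mult.commute)
  qed
  finally show ?thesis .
qed

lemma tail_inverse: "1 / emeasure P {\<omega> \<in> space P. ord_stat (Z \<omega>) i > t} = ennreal (1 / U t)"
  unfolding emeasure_eq_measure U_def[symmetric] using divide_ennreal[of 1 "U t"] U_pos[of t] by simp

lemma limit_measure_eq: "limit_measure P A \<mu> k i = \<nu>"
  and measure_space_limit_fun: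
    "measure_space (subcone k) (sets (subcone_borel k :: (real ^ 'q) measure)) (limit_fun P A \<mu> k i)"
proof -
  have sp: "space \<nu> = subcone k" by (rule space_subcone_borel[OF k sets_\<nu>])
  have eq: "emeasure \<nu> S = limit_fun P A \<mu> k i S" if "S \<in> sigma_sets (space \<nu>) (sets \<nu>)" for S
    using that emeasure_\<nu> by (simp add: sets.sigma_sets_eq)
  show "limit_measure P A \<mu> k i = \<nu>"
    unfolding limit_measure_def sp[symmetric] sets_\<nu>[symmetric]
    using measure_of_eq[of "sets \<nu>" "space \<nu>" "emeasure \<nu>" "limit_fun P A \<mu> k i"] sets.space_closed[of \<nu>] eq measure_of_of_measure[of \<nu>] by simp
  show "measure_space (subcone k) (sets (subcone_borel k :: (real ^ 'q) measure)) (limit_fun P A \<mu> k i)"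
    unfolding sp[symmetric] sets_\<nu>[symmetric]
    using measure_space_eq[of "sets \<nu>" "space \<nu>" "emeasure \<nu>" "limit_fun P A \<mu> k i"] sets.space_closed[of \<nu>] eq measure_space[of \<nu>]
    by (simp add: sets.sigma_sets_eq)
qed

text \<open>For \<omega> in \<open>\<Omega>\<close>,
  \<open>a \<le> ord_stat (A \<omega> *v z) k\<close> forces \<open>ord_stat z i \<ge> 1 / x\<close>
  with \<open>x = 2 * \<tau> \<omega> / a + 1\<close>. So \<open>potter_\<mu>\<close> bounds the
  inner mass by a multiple of \<open>x powr p\<close>, which the moment condition makes
  integrable.\<close>

lemma \<nu>_class: "\<nu> \<in> M_class k"
proof (rule M_classI[OF k sets_\<nu>])
  fix a :: real assume a: "0 < a"
  obtain C t0 where "0 < t0" and C: "0 \<le> C"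
    and potter: "\<And>t x. t0 \<le> t \<Longrightarrow> 1 \<le> x \<Longrightarrow> U (t / x) \<le> C * x powr p * U t"
    using potter[OF p] by blast
  let ?S = "{x \<in> subcone k. a \<le> ord_stat x k} :: (real ^ 'q) set"
  let ?W = "\<lambda>\<omega>. C * 3 powr p * (indicator \<Omega> \<omega> * (2 * \<tau> \<omega> / a + 1) powr p)"
  have "emeasure \<nu> ?S = limit_fun P A \<mu> k i ?S"
    by (rule emeasure_\<nu>[OF sets_ord_stat_ge[OF k sets_\<nu>]])
  also have "\<dots> \<le> (\<integral>\<^sup>+\<omega>. ennreal (?W \<omega>) \<partial>P)"
    unfolding limit_fun_def
  proof (rule nn_integral_mono)
    fix \<omega> assume "\<omega> \<in> space P"
    show "emeasure \<mu> {z \<in> subcone i. A \<omega> *v z \<in> ?S} * indicator \<Omega> \<omega> \<le> ennreal (?W \<omega>)"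
    proof (cases "\<omega> \<in> \<Omega>")
      case True
      let ?x = "2 * \<tau> \<omega> / a + 1"
      have x: "1 \<le> ?x" using \<tau>_nonneg[of \<omega>] a by simp
      have "1 / ?x \<le> ord_stat z i" if z: "z \<in> subcone i" and Az: "a \<le> ord_stat (A \<omega> *v z) k" for z
      proof -
        have z': "z \<in> nonneg_orthant" "0 < ord_stat z i" using z by (auto simp: subcone_eq[OF i])
        have "a \<le> \<tau> \<omega> * ord_stat z i" using ord_stat_A_le[OF True z'(1)] Az by simp
        then have "1 \<le> (\<tau> \<omega> / a) * ord_stat z i" using a by (simp add: field_simps)
        moreover have "0 \<le> (\<tau> \<omega> / a) * ord_stat z i" using calculation by simp
        moreover have "?x * ord_stat z i = 2 * ((\<tau> \<omega> / a) * ord_stat z i) + ord_stat z i"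
          by (simp add: algebra_simps)
        ultimately have "1 \<le> ?x * ord_stat z i" using z'(2) by linarith
        then show ?thesis using x by (simp add: pos_divide_le_eq mult.commute)
      qed
      then have "emeasure \<mu> {z \<in> subcone i. A \<omega> *v z \<in> ?S}
          \<le> emeasure \<mu> {z \<in> subcone i. 1 / ?x \<le> ord_stat z i}"
        by (intro emeasure_mono sets_ord_stat_ge[OF i sets_\<mu>]) auto
      also have "\<dots> \<le> ennreal (C * (3 * ?x) powr p)" by (rule potter_\<mu>[OF potter x])
      also have "C * (3 * ?x) powr p = ?W \<omega>"
      proof -
        have "(3 * ?x) powr p = 3 powr p * ?x powr p" by (rule powr_mult)
        with True show ?thesis by (simp only: indicator_simps mult_1_left mult.assoc)
      qed
      finally show ?thesis using True by simp
    qed simp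
  qed
  also have "\<dots> = ennreal (\<integral>\<omega>. ?W \<omega> \<partial>P)"
    using C by (intro nn_integral_eq_integral integrable_mult_right integrable_moment a AE_I2) auto
  also have "\<dots> < \<infinity>" by simp
  finally show "emeasure \<nu> ?S < \<infinity>" .
qed

section \<open>Convergence of integrals for a fixed test function and its zero extension\<close>

context
  fixes f :: "real ^ 'q \<Rightarrow> real" and F :: "real ^ 'q \<Rightarrow> real" and a M :: real
  assumes f: "f \<in> M_test k"
    and F_def: "F = (\<lambda>x. if x \<in> subcone k then f x else 0)"
    and F: "test_fun k a M F"
begin

lemma f_continuous: "continuous_on (subcone k) f"
  using f by (simp add: M_test_def)

lemma F_measurable [measurable]: "F \<in> borel_measurable borel"
proof -
  have "(\<lambda>x. indicator (subcone k) x *\<^sub>R f x) \<in> borel_measurable borel"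
    using borel_measurable_continuous_on_restrict[OF f_continuous] sets_subcone[OF k]
    by (subst (asm) borel_measurable_restrict_space_iff) auto
  also have "(\<lambda>x. indicator (subcone k) x *\<^sub>R f x) = F" by (auto simp: F_def)
  finally show ?thesis .
qed

lemma F_A_measurable [measurable]:
  "(\<lambda>(\<omega>, z). F (A \<omega> *v z)) \<in> borel_measurable (P_part P A k i \<Otimes>\<^sub>M \<mu>)"
  "(\<lambda>(\<omega>, z). F (A \<omega> *v z)) \<in> borel_measurable (P \<Otimes>\<^sub>M \<mu>)"
  "(\<lambda>(\<omega>, z). F ((A \<omega> *v Z z) /\<^sub>R t)) \<in> borel_measurable (P \<Otimes>\<^sub>M P)"
proof -
  show "(\<lambda>(\<omega>, z). F (A \<omega> *v z)) \<in> borel_measurable (P_part P A k i \<Otimes>\<^sub>M \<mu>)"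
    using measurable_compose[OF A_mult_measurable(1) F_measurable] by (simp add: case_prod_beta)
  show "(\<lambda>(\<omega>, z). F (A \<omega> *v z)) \<in> borel_measurable (P \<Otimes>\<^sub>M \<mu>)"
    using measurable_compose[OF A_mult_measurable(2) F_measurable] by (simp add: case_prod_beta)
  have "(\<lambda>x. (case x of (\<omega>, z) \<Rightarrow> A \<omega> *v Z z) /\<^sub>R t) \<in> borel_measurable (P \<Otimes>\<^sub>M P)" by measurable
  from measurable_compose[OF this F_measurable]
  show "(\<lambda>(\<omega>, z). F ((A \<omega> *v Z z) /\<^sub>R t)) \<in> borel_measurable (P \<Otimes>\<^sub>M P)"
    by (simp add: case_prod_beta)
qed

lemma F_eq_0: "x \<notin> subcone k \<Longrightarrow> F x = 0"
  by (simp add: F_def)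

lemma abs_F_le: "\<bar>F x\<bar> \<le> M"
  using test_funD(2,4)[OF F] F_eq_0[of x] by (cases "x \<in> subcone k") (auto simp: subcone_def)

lemma integral_\<nu>:
  "integral\<^sup>L \<nu> f = (\<integral>\<omega>. indicator \<Omega> \<omega> * (\<integral>z. F (A \<omega> *v z) \<partial>\<mu>) \<partial>P)"
proof -
  interpret \<mu>: sigma_finite_measure \<mu> by (rule sigma_finite_M_class[OF i \<mu>_class])
  interpret PP: finite_measure "P_part P A k i" by (rule finite_P_part)
  interpret pair_sigma_finite "P_part P A k i" \<mu> ..
  note sets_subcone[OF k, measurable]
  let ?D = "distr (P_part P A k i \<Otimes>\<^sub>M \<mu>) borel (\<lambda>(\<omega>, z). A \<omega> *v z)"
  have ind: "(\<lambda>x. indicator (subcone k) x * F x) = F" by (auto simp: F_def indicator_def)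
  have "integrable \<nu> F" by (rule test_fun_integrable[OF k \<nu>_class F])
  then have "integrable ?D F"
    unfolding \<nu>_def by (subst (asm) integrable_restrict_space) (auto simp: ind)
  then have int: "integrable (P_part P A k i \<Otimes>\<^sub>M \<mu>) (\<lambda>(\<omega>, z). F (A \<omega> *v z))"
    by (subst (asm) integrable_distr_eq) (auto simp: case_prod_unfold)
  have "integral\<^sup>L \<nu> f = integral\<^sup>L \<nu> F"
    by (rule Bochner_Integration.integral_cong) (auto simp: F_def space_subcone_borel[OF k sets_\<nu>])
  also have "\<dots> = integral\<^sup>L ?D F"
    unfolding \<nu>_def by (subst integral_restrict_space) (auto simp: ind)
  also have "\<dots> = integral\<^sup>L (P_part P A k i \<Otimes>\<^sub>M \<mu>) (\<lambda>(\<omega>, z). F (A \<omega> *v z))"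
    by (subst integral_distr) (auto simp: case_prod_unfold)
  also have "\<dots> = (\<integral>\<omega>. (\<integral>z. F (A \<omega> *v z) \<partial>\<mu>) \<partial>P_part P A k i)"
    using integral_fst'[OF int] by simp
  also have "\<dots> = (\<integral>\<omega>. (\<integral>z. F (A \<omega> *v z) \<partial>\<mu>) \<partial>density P (\<lambda>\<omega>. ennreal (indicator \<Omega> \<omega>)))"
    by (simp add: P_part_def ennreal_indicator)
  also have "\<dots> = (\<integral>\<omega>. indicator \<Omega> \<omega> * (\<integral>z. F (A \<omega> *v z) \<partial>\<mu>) \<partial>P)"
    using \<mu>.borel_measurable_lebesgue_integral[OF F_A_measurable(2)]
    by (subst integral_density) auto
  finally show ?thesis .
qed

text \<open>Independence enters here: it separates the expectation over \<open>Z\<close> from the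
  one over the matrix.\<close>

lemma integral_normalised_law:
  "integral\<^sup>L (normalised_law P A Z k i t) f
    = (\<integral>\<omega>. indicator \<Omega> \<omega> * ((\<integral>\<omega>'. F ((A \<omega> *v Z \<omega>') /\<^sub>R t) \<partial>P) / U t) \<partial>P)"
proof -
  have AZ: "(\<lambda>\<omega>. A \<omega> *v Z \<omega>) \<in> borel_measurable P"
    by (rule measurable_matrix_vector_mult) measurable
  then have AZ': "(\<lambda>\<omega>. (A \<omega> *v Z \<omega>) /\<^sub>R t) \<in> borel_measurable (P_part P A k i)"
    by (simp add: measurable_cong_sets[OF sets_P_part refl])
  have FAZ: "(\<lambda>\<omega>. F ((A \<omega> *v Z \<omega>) /\<^sub>R t)) \<in> borel_measurable P"
    using AZ by measurable
  \<comment> \<open>Membership in \<open>\<Omega>\<close> is written as a condition on the matrix,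
    so that the whole integrand is a function of the pair of \<open>A\<close> and
    \<open>Z\<close>.\<close>
  let ?g = "\<lambda>(B :: real ^ 'd ^ 'q, z). (if index_of k B = i then F ((B *v z) /\<^sub>R t) else 0)"
  have g: "?g \<in> borel_measurable (borel \<Otimes>\<^sub>M borel)"
  proof -
    have [measurable]: "(\<lambda>x :: (real ^ 'd ^ 'q) \<times> (real ^ 'd). fst x *v snd x) \<in> borel_measurable (borel \<Otimes>\<^sub>M borel)"
      by (rule measurable_matrix_vector_mult) measurable
    note measurable_index_of[OF k, measurable]
    show ?thesis unfolding case_prod_beta by measurable
  qed
  note joint = distr_indep_rv[OF prob_space_axioms A_measurable Z_measurable indep]
  interpret pair_prob_space P P ..
  have ind: "indicator \<Omega> \<omega> * y = (if index_of k (A \<omega>) = i then y else 0)" if "\<omega> \<in> space P" for \<omega> and y :: real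
    using that by (auto simp: \<Omega>_part_def)
  have "integral\<^sup>L (normalised_law P A Z k i t) f
      = 1 / U t * (\<integral>\<omega>. F ((A \<omega> *v Z \<omega>) /\<^sub>R t) \<partial>P_part P A k i)"
    unfolding normalised_law_def tail_inverse using U_nonneg[of t]
    by (subst integral_scaled_restricted_law[OF k f_continuous AZ']) (auto simp: F_def)
  also have "(\<integral>\<omega>. F ((A \<omega> *v Z \<omega>) /\<^sub>R t) \<partial>P_part P A k i)
      = (\<integral>\<omega>. F ((A \<omega> *v Z \<omega>) /\<^sub>R t) \<partial>density P (\<lambda>\<omega>. ennreal (indicator \<Omega> \<omega>)))"
    by (simp add: P_part_def ennreal_indicator)
  also have "\<dots> = (\<integral>\<omega>. indicator \<Omega> \<omega> * F ((A \<omega> *v Z \<omega>) /\<^sub>R t) \<partial>P)"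
    using FAZ by (subst integral_density) auto
  also have "\<dots> = (\<integral>\<omega>. ?g (A \<omega>, Z \<omega>) \<partial>P)"
    by (rule Bochner_Integration.integral_cong) (auto simp: ind)
  also have "\<dots> = integral\<^sup>L (distr P (borel \<Otimes>\<^sub>M borel) (\<lambda>\<omega>. (A \<omega>, Z \<omega>))) ?g"
    by (subst integral_distr[OF _ g]) auto
  also have "\<dots> = integral\<^sup>L (P \<Otimes>\<^sub>M P) (\<lambda>x. ?g (case x of (\<omega>, \<omega>') \<Rightarrow> (A \<omega>, Z \<omega>')))"
    unfolding joint
    by (rule integral_distr[OF _ g]) measurable
  also have "\<dots> = (\<integral>\<omega>. (\<integral>\<omega>'. ?g (A \<omega>, Z \<omega>') \<partial>P) \<partial>P)"
  proof -
    have "integrable (P \<Otimes>\<^sub>M P) (\<lambda>x. ?g (case x of (\<omega>, \<omega>') \<Rightarrow> (A \<omega>, Z \<omega>')))"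
    proof (rule P.integrable_const_bound[where B = M])
      show "AE x in P \<Otimes>\<^sub>M P. norm (?g (case x of (\<omega>, \<omega>') \<Rightarrow> (A \<omega>, Z \<omega>'))) \<le> M"
        using abs_F_le test_funD(2)[OF F] by (intro AE_I2) (auto split: prod.split)
      show "(\<lambda>x. ?g (case x of (\<omega>, \<omega>') \<Rightarrow> (A \<omega>, Z \<omega>'))) \<in> borel_measurable (P \<Otimes>\<^sub>M P)"
        by (rule measurable_compose[OF _ g]) measurable
    qed
    from integral_fst'[OF this] show ?thesis by simp
  qed
  also have "\<dots> = (\<integral>\<omega>. indicator \<Omega> \<omega> * (\<integral>\<omega>'. F ((A \<omega> *v Z \<omega>') /\<^sub>R t) \<partial>P) \<partial>P)"
    by (rule Bochner_Integration.integral_cong) (auto simp: ind)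
  finally show ?thesis by (simp add: field_simps flip: Bochner_Integration.integral_mult_right_zero)
qed

text \<open>From \<open>F (A \<omega> *v z) \<noteq> 0\<close> follows
  \<open>a \<le> \<tau> \<omega> * ord_stat z i\<close>; adding 1 to \<open>\<tau> \<omega>\<close>
  covers the case that it is 0.\<close>

lemma conditional_test_fun:
  assumes \<omega>: "\<omega> \<in> \<Omega>"
  shows "test_fun i (a / (\<tau> \<omega> + 1)) M (\<lambda>z. F (A \<omega> *v z))"
proof -
  note FD = test_funD[OF F]
  have orth: "A \<omega> *v z \<in> nonneg_orthant" if "z \<in> nonneg_orthant" for z
    using A_orthant[OF \<Omega>_subset[OF \<omega>] that] .
  have "continuous_on nonneg_orthant (\<lambda>z. F (A \<omega> *v z))"
    by (rule continuous_on_compose2[OF FD(3)]) (auto intro!: continuous_intros orth)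
  moreover have "a / (\<tau> \<omega> + 1) \<le> ord_stat z i"
    if z: "z \<in> nonneg_orthant" and "F (A \<omega> *v z) \<noteq> 0" for z
  proof -
    have "a \<le> \<tau> \<omega> * ord_stat z i" using FD(5)[OF orth[OF z]] that ord_stat_A_le[OF \<omega> z] by simp
    then have "a \<le> ord_stat z i * (\<tau> \<omega> + 1)"
      using ord_stat_nonneg[OF i z] by (simp add: algebra_simps)
    then show ?thesis using \<tau>_nonneg[of \<omega>] by (simp add: pos_divide_le_eq)
  qed
  ultimately show ?thesis
    using FD(1,2) FD(4) orth \<tau>_nonneg[of \<omega>] by (auto simp: test_fun_def)
qed

text \<open>The integrand can be nonzero only if
  \<open>t \<le> \<tau> \<omega> / a * ord_stat (Z \<omega>') i\<close>, which puts
  \<open>\<omega>'\<close> in a tail event for \<open>Z\<close> alone. The argument of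
  \<open>U\<close> has the form required by Potter's bound.\<close>

lemma conditional_bound:
  assumes \<omega>: "\<omega> \<in> \<Omega>" and t: "0 < t"
  shows "\<bar>\<integral>\<omega>'. F ((A \<omega> *v Z \<omega>') /\<^sub>R t) \<partial>P\<bar> \<le> M * U (t / (2 * \<tau> \<omega> / a + 1))"
proof -
  note FD = test_funD[OF F]
  let ?x = "2 * \<tau> \<omega> / a + 1"
  let ?S = "{\<omega>' \<in> space P. t / ?x < ord_stat (Z \<omega>') i}"
  have x: "1 \<le> ?x" using FD(1) \<tau>_nonneg[of \<omega>] by simp
  have ptw: "\<bar>F ((A \<omega> *v Z \<omega>') /\<^sub>R t)\<bar> \<le> M * indicator ?S \<omega>'" if \<omega>': "\<omega>' \<in> space P" for \<omega>'
  proof (cases "F ((A \<omega> *v Z \<omega>') /\<^sub>R t) = 0")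
    case True
    then show ?thesis using FD(2) by simp
  next
    case False
    note Zo = Z_nonneg[OF \<omega>']
    have AZ: "A \<omega> *v Z \<omega>' \<in> nonneg_orthant" using A_orthant[OF \<Omega>_subset[OF \<omega>] Zo] .
    have "a \<le> ord_stat ((A \<omega> *v Z \<omega>') /\<^sub>R t) k"
      using False t by (intro FD(5) scaleR_nonneg_orthant AZ) auto
    also have "\<dots> = ord_stat (A \<omega> *v Z \<omega>') k / t"
      using ord_stat_scale[OF k, of "inverse t"] t by (simp add: divide_inverse_commute)
    also have "\<dots> \<le> \<tau> \<omega> * ord_stat (Z \<omega>') i / t"
      using ord_stat_A_le[OF \<omega> Zo] t by (intro divide_right_mono) auto
    finally have "t \<le> \<tau> \<omega> / a * ord_stat (Z \<omega>') i" using t FD(1) by (simp add: field_simps)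
    then have "t < ?x * ord_stat (Z \<omega>') i"
      using t ord_stat_Z_nonneg[OF \<omega>'] by (simp add: algebra_simps)
    then have "\<omega>' \<in> ?S" using x \<omega>' by (simp add: pos_divide_less_eq mult.commute)
    with abs_F_le show ?thesis by simp
  qed
  have meas: "(\<lambda>\<omega>'. F ((A \<omega> *v Z \<omega>') /\<^sub>R t)) \<in> borel_measurable P"
  proof -
    have [measurable]: "(\<lambda>\<omega>'. A \<omega> *v Z \<omega>') \<in> borel_measurable P"
      by (rule measurable_matrix_vector_mult) measurable
    show ?thesis by measurable
  qed
  have "\<bar>\<integral>\<omega>'. F ((A \<omega> *v Z \<omega>') /\<^sub>R t) \<partial>P\<bar> \<le> (\<integral>\<omega>'. \<bar>F ((A \<omega> *v Z \<omega>') /\<^sub>R t)\<bar> \<partial>P)"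
    by (rule integral_abs_bound)
  also have "\<dots> \<le> (\<integral>\<omega>'. M * indicator ?S \<omega>' \<partial>P)"
  proof (rule integral_mono)
    show "integrable P (\<lambda>\<omega>'. \<bar>F ((A \<omega> *v Z \<omega>') /\<^sub>R t)\<bar>)"
      using meas abs_F_le by (intro integrable_abs integrable_const_bound[where B = M] AE_I2) auto
    show "integrable P (\<lambda>\<omega>'. M * indicator ?S \<omega>')"
      by (intro integrable_mult_right integrable_real_indicator) (auto simp: emeasure_eq_measure)
  qed (rule ptw)
  also have "\<dots> = M * U (t / ?x)" by (simp add: U_def)
  finally show ?thesis .
qed

lemma normalised_law_limit:
  "((\<lambda>t. integral\<^sup>L (normalised_law P A Z k i t) f) \<longlongrightarrow> integral\<^sup>L \<nu> f) at_top"
  unfolding integral_normalised_law integral_\<nu>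
proof -
  note FD = test_funD[OF F]
  obtain C t0 where t0: "0 < t0" and C: "0 \<le> C"
    and potter: "\<And>t x. t0 \<le> t \<Longrightarrow> 1 \<le> x \<Longrightarrow> U (t / x) \<le> C * x powr p * U t"
    using potter[OF p] by blast
  interpret \<mu>: sigma_finite_measure \<mu> by (rule sigma_finite_M_class[OF i \<mu>_class])
  let ?s = "\<lambda>t \<omega>. indicator \<Omega> \<omega> * ((\<integral>\<omega>'. F ((A \<omega> *v Z \<omega>') /\<^sub>R t) \<partial>P) / U t)"
  let ?l = "\<lambda>\<omega>. indicator \<Omega> \<omega> * (\<integral>z. F (A \<omega> *v z) \<partial>\<mu>)"
  \<comment> \<open>Potter's bound contributes a factor \<open>U t\<close> that cancels the
    normalisation, so this majorant is free of \<open>t\<close>.\<close>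
  let ?w = "\<lambda>\<omega>. M * C * (indicator \<Omega> \<omega> * (2 * \<tau> \<omega> / a + 1) powr p)"
  show "((\<lambda>t. integral\<^sup>L P (?s t)) \<longlongrightarrow> integral\<^sup>L P ?l) at_top"
  proof (rule integral_dominated_convergence_at_top)
    show "?l \<in> borel_measurable P"
      using \<mu>.borel_measurable_lebesgue_integral[OF F_A_measurable(2)] by measurable
    show "?s t \<in> borel_measurable P" for t
      using borel_measurable_lebesgue_integral[OF F_A_measurable(3)] by measurable
    show "integrable P ?w" by (intro integrable_mult_right integrable_moment FD)
    show "AE \<omega> in P. ((\<lambda>t. ?s t \<omega>) \<longlongrightarrow> ?l \<omega>) at_top"
    proof (rule AE_I2)
      fix \<omega>
      show "((\<lambda>t. ?s t \<omega>) \<longlongrightarrow> ?l \<omega>) at_top"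
      proof (cases "\<omega> \<in> \<Omega>")
        case True
        from tail_scaled_limit[OF conditional_test_fun[OF True]] True
        show ?thesis by (simp add: matrix_vector_mult_scaleR)
      qed simp
    qed
    show "\<forall>\<^sub>F t in at_top. AE \<omega> in P. norm (?s t \<omega>) \<le> ?w \<omega>"
      using eventually_ge_at_top[of t0]
    proof eventually_elim
      case (elim t)
      have "norm (?s t \<omega>) \<le> ?w \<omega>" for \<omega>
      proof (cases "\<omega> \<in> \<Omega>")
        case True
        have "1 \<le> 2 * \<tau> \<omega> / a + 1" using FD(1) \<tau>_nonneg[of \<omega>] by simp
        then have "M * U (t / (2 * \<tau> \<omega> / a + 1)) \<le> M * (C * (2 * \<tau> \<omega> / a + 1) powr p * U t)"
          using FD(2) elim by (intro mult_left_mono potter) auto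
        with conditional_bound[OF True, of t] t0 elim
        have "\<bar>\<integral>\<omega>'. F ((A \<omega> *v Z \<omega>') /\<^sub>R t) \<partial>P\<bar> \<le> M * C * (2 * \<tau> \<omega> / a + 1) powr p * U t"
          by (simp add: mult_ac)
        then show ?thesis using True U_pos[of t] by (simp add: pos_divide_le_eq)
      qed simp
      then show ?case by (intro AE_I2)
    qed
  qed
qed

end

lemma normalised_law_class: "normalised_law P A Z k i t \<in> M_class k"
proof (rule M_classI[OF k])
  interpret PP: finite_measure "P_part P A k i" by (rule finite_P_part)
  show "sets (normalised_law P A Z k i t) = sets (subcone_borel k)"
    by (simp add: normalised_law_def subcone_borel_def sets_restrict_space)
  fix a :: real
  let ?S = "{x \<in> subcone k. a \<le> ord_stat x k} :: (real ^ 'q) set"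
  let ?D = "distr (P_part P A k i) borel (\<lambda>\<omega>. (A \<omega> *v Z \<omega>) /\<^sub>R t)"
  have AZ: "(\<lambda>\<omega>. A \<omega> *v Z \<omega>) \<in> borel_measurable P"
    by (rule measurable_matrix_vector_mult) measurable
  then have AZ': "(\<lambda>\<omega>. (A \<omega> *v Z \<omega>) /\<^sub>R t) \<in> borel_measurable (P_part P A k i)"
    by (simp add: measurable_cong_sets[OF sets_P_part refl])
  interpret D: finite_measure ?D by (rule PP.finite_measure_distr[OF AZ'])
  have "emeasure (restrict_space ?D (subcone k)) ?S = emeasure ?D ?S"
    using sets_subcone[OF k] by (intro emeasure_restrict_space) auto
  then have "emeasure (restrict_space ?D (subcone k)) ?S < \<infinity>"
    by (simp add: D.emeasure_eq_measure)
  then show "emeasure (normalised_law P A Z k i t) ?S < \<infinity>"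
    unfolding normalised_law_def tail_inverse by (simp add: ennreal_mult_less_top)
qed

lemma converges: "M_converges k (normalised_law P A Z k i) (limit_measure P A \<mu> k i)"
  unfolding M_converges_def limit_measure_eq
proof (intro conjI ballI)
  fix f :: "real ^ 'q \<Rightarrow> real" assume f: "f \<in> M_test k"
  obtain a M where "test_fun k a M (\<lambda>x. if x \<in> subcone k then f x else 0)"
    using test_fun_of_M_test[OF k f] .
  from normalised_law_limit[OF f refl this]
  show "((\<lambda>t. integral\<^sup>L (normalised_law P A Z k i t) f) \<longlongrightarrow> integral\<^sup>L \<nu> f) at_top" .
qed (use normalised_law_class \<nu>_class in auto)

end

theorem theorem3p6:
  fixes P :: "'w measure"
    and A :: "'w \<Rightarrow> real ^ 'd::finite ^ 'q::finite"
    and Z :: "'w \<Rightarrow> real ^ 'd"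
    and \<alpha> :: real and \<mu> :: "(real ^ 'd) measure" and i k :: nat
  assumes "prob_space P"
    and "i \<in> {1..CARD('d)}"
    and "k \<in> {1..CARD('q)}"
    and "Z \<in> borel_measurable P"
    and "\<And>\<omega>. \<omega> \<in> space P \<Longrightarrow> Z \<omega> \<in> nonneg_orthant"
    and "MRV P Z \<alpha> (canonical_scaling P Z i) \<mu> i"
    and "A \<in> borel_measurable P"
    and "\<And>\<omega> r c. \<omega> \<in> space P \<Longrightarrow> 0 \<le> A \<omega> $ r $ c"
    and "indep_rv P A Z"
    and "AE \<omega> in P. \<forall>r. row r (A \<omega>) \<noteq> 0"
    and "\<exists>\<delta>>0. (\<integral>\<^sup>+\<omega>\<in>\<Omega>_part P A k i.
           ennreal (enn2real (\<tau>_mat k i (A \<omega>)) powr (\<alpha> + \<delta>)) \<partial>P) < \<infinity>"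
    and "\<And>J :: 'd set. card J = i \<Longrightarrow> 0 < emeasure \<mu> (open_face J)"
  shows "measure_space (subcone k) (sets (subcone_borel k :: (real ^ 'q) measure))
           (limit_fun P A \<mu> k i) \<and>
         M_converges k (normalised_law P A Z k i) (limit_measure P A \<mu> k i)"
proof -
  from assms(11) obtain \<delta> where \<delta>: "0 < \<delta>"
    "(\<integral>\<^sup>+\<omega>\<in>\<Omega>_part P A k i. ennreal (enn2real (\<tau>_mat k i (A \<omega>)) powr (\<alpha> + \<delta>)) \<partial>P) < \<infinity>"
    by blast
  interpret prob_space P by fact
  interpret mrv_random_matrix P Z \<alpha> \<mu> i A k "\<alpha> + \<delta>"
    by unfold_locales (use assms \<delta> in auto)
  show ?thesis using measure_space_limit_fun converges by blast
qed

end
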